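(* Consider a random walk model in the quarter plane with small steps, non-degenerate and with zero drift (as described in the context), with kernel $K(x,y)$, branch $X_+(y)$ and conformal gluing function $\omega$ as in the context. Then for every discrete harmonic function $h:\mathbb{Z}_{\ge 0}^2\to\mathbb{R}$ (with Dirichlet boundary conditions) with generating function $H(x,y)$ there is a unique formal power series $P(x)$ such that $$H(x,y)=\frac{P\big(\omega(x)\big)-P\big(\omega(X_+(y))\big)}{K(x,y)}.$$ In particular, the real vector space $\mathcal{H}_1$ of such discrete harmonic functions is isomorphic to $\mathbb{R}[[x]]$.
   Context: A model is given by transition probabilities $p_{i,j}\ge 0$, $(i,j)\in\{-1,0,1\}^2$, summing to $1$ (small steps), such that the cyclic list $p_{1,1},p_{1,0},p_{1,-1},p_{0,-1},p_{-1,-1},p_{-1,0},p_{-1,1},p_{0,1}$ contains no three consecutive zeros (non-degenerate), and $\sum ip_{i,j}=\sum jp_{i,j}=0$ (zero drift). For $f:\mathbb{Z}_{\ge0}^2\to\mathbb{R}$, extended by $0$ outside $\mathbb{Z}_{\ge0}^2$ (Dirichlet boundary conditions), the discrete Laplacian is $\Delta f(i,j)=\sum_{(u,v)}p_{u,v}f(i+u,j+v)-f(i,j)$ for $(i,j)\in\mathbb{Z}_{\ge0}^2$; $f$ is harmonic if $\Delta f=0$ on $\mathbb{Z}_{\ge 0}^2$. The generating function of $h$ is $H(x,y)=\sum_{i,j\ge0}h(i,j)x^iy^j$. The kernel is $K(x,y)=xy\big(\sum p_{i,j}x^{-i}y^{-j}-1\big)=\tilde a(y)x^2+\tilde b(y)x+\tilde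 c(y)$, and $X_\pm(y)=\frac{-\tilde b(y)\pm\sqrt{\tilde b(y)^2-4\tilde a(y)\tilde c(y)}}{2\tilde a(y)}$ are the roots of $K(\cdot,y)=0$. The discriminant $\tilde b^2-4\tilde a\tilde c$ has a double root at $y=1$, a root $y_1\in[-1,1)$ and a root in $(1,\infty)\cup(-\infty,-1]$; for $y\in[y_1,1]$, $X_+(y)=\overline{X_-(y)}$. Let $\mathcal{G}$ be the domain bounded by the curve $X_\pm([y_1,1])$, and let $\theta=\arccos\Big(-\frac{\sum ij p_{i,j}}{\sqrt{\sum i^2p_{i,j}}\sqrt{\sum j^2p_{i,j}}}\Big)$. The function $\omega$ is the (fixed) conformal gluing function of $\mathcal{G}$: it is analytic in the interior of $\mathcal{G}$, continuous on $\overline{\mathcal{G}}\setminus\{1\}$, conformal on $\mathcal{G}$ (non-vanishing derivative in the interior), satisfies $\omega(0)=0$ and $\omega(X_+(y))=\omega(X_-(y))$ for all $y\in[y_1,1]$, has a pole-like singularity of order $\pi/\theta$ at $x=1$, and every solution of the boundary value problem $g(X_+(y))=g(X_-(y))$, $y\in[y_1,1]$ (with $g$ analytic in $\mathcal{G}$) is an entire function of $\omega$.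
   Formalization: The formula is proved for p_{1,1}=0 only (otherwise K is a unit and H=y/K is harmonic but has no such P); P is unique once normalised by P(0)=0, since constants cancel; P is complex, and real when ω is real-symmetric. The isomorphism with R[[x]] covers all models. *)

theory Defs
  imports "HOL-Complex_Analysis.Complex_Analysis"
begin

text \<open>Only the values \<open>p i j\<close> with \<open>i, j \<in> {-1, 0, 1}\<close> are ever used.\<close>

abbreviation steps :: "int set" where
  "steps \<equiv> {-1, 0, 1}"

definition transition_probabilities :: "(int \<Rightarrow> int \<Rightarrow> real) \<Rightarrow> bool" where
  "transition_probabilities p \<longleftrightarrow>
     (\<forall>i\<in>steps. \<forall>j\<in>steps. p i j \<ge> 0) \<and> (\<Sum>i\<in>steps. \<Sum>j\<in>steps. p i j) = 1"

definition nondegenerate :: "(int \<Rightarrow> int \<Rightarrow> real) \<Rightarrow> bool" where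
  "nondegenerate p \<longleftrightarrow>
     (let L = [p 1 1, p 1 0, p 1 (-1), p 0 (-1), p (-1) (-1), p (-1) 0, p (-1) 1, p 0 1]
      in \<not> (\<exists>k<8. L ! k = 0 \<and> L ! ((k + 1) mod 8) = 0 \<and> L ! ((k + 2) mod 8) = 0))"

definition zero_drift :: "(int \<Rightarrow> int \<Rightarrow> real) \<Rightarrow> bool" where
  "zero_drift p \<longleftrightarrow>
     (\<Sum>i\<in>steps. \<Sum>j\<in>steps. of_int i * p i j) = 0 \<and>
     (\<Sum>i\<in>steps. \<Sum>j\<in>steps. of_int j * p i j) = 0"

definition extend_by_0 :: "(nat \<Rightarrow> nat \<Rightarrow> real) \<Rightarrow> int \<Rightarrow> int \<Rightarrow> real" where
  "extend_by_0 f i j = (if i \<ge> 0 \<and> j \<ge> 0 then f (nat i) (nat j) else 0)"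

definition laplacian ::
  "(int \<Rightarrow> int \<Rightarrow> real) \<Rightarrow> (nat \<Rightarrow> nat \<Rightarrow> real) \<Rightarrow> nat \<Rightarrow> nat \<Rightarrow> real" where
  "laplacian p f i j =
     (\<Sum>u\<in>steps. \<Sum>v\<in>steps. p u v * extend_by_0 f (int i + u) (int j + v)) - f i j"

definition harmonic_functions :: "(int \<Rightarrow> int \<Rightarrow> real) \<Rightarrow> (nat \<Rightarrow> nat \<Rightarrow> real) set" where
  "harmonic_functions p = {h. \<forall>i j. laplacian p h i j = 0}"

text \<open>
  The coefficients of the kernel \<open>K(x,y) = xy (\<Sum> p\<^sub>i\<^sub>j x\<^sup>-\<^sup>i y\<^sup>-\<^sup>j - 1)\<close> as a polynomial in \<open>x\<close>;
  the negative powers are cleared by the factor \<open>xy\<close>.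
\<close>

definition a_tilde :: "(int \<Rightarrow> int \<Rightarrow> real) \<Rightarrow> complex \<Rightarrow> complex" where
  "a_tilde p y = (\<Sum>j\<in>steps. of_real (p (-1) j) * y ^ nat (1 - j))"

definition b_tilde :: "(int \<Rightarrow> int \<Rightarrow> real) \<Rightarrow> complex \<Rightarrow> complex" where
  "b_tilde p y = (\<Sum>j\<in>steps. of_real (p 0 j) * y ^ nat (1 - j)) - y"

definition c_tilde :: "(int \<Rightarrow> int \<Rightarrow> real) \<Rightarrow> complex \<Rightarrow> complex" where
  "c_tilde p y = (\<Sum>j\<in>steps. of_real (p 1 j) * y ^ nat (1 - j))"

definition discr :: "(int \<Rightarrow> int \<Rightarrow> real) \<Rightarrow> complex \<Rightarrow> complex" where
  "discr p y = (b_tilde p y)\<^sup>2 - 4 * a_tilde p y * c_tilde p y"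

definition X_plus :: "(int \<Rightarrow> int \<Rightarrow> real) \<Rightarrow> complex \<Rightarrow> complex" where
  "X_plus p y = (- b_tilde p y + csqrt (discr p y)) / (2 * a_tilde p y)"

definition X_minus :: "(int \<Rightarrow> int \<Rightarrow> real) \<Rightarrow> complex \<Rightarrow> complex" where
  "X_minus p y = (- b_tilde p y - csqrt (discr p y)) / (2 * a_tilde p y)"

definition boundary_curve :: "(int \<Rightarrow> int \<Rightarrow> real) \<Rightarrow> real \<Rightarrow> complex set" where
  "boundary_curve p y1 =
     (\<lambda>y. X_plus p (of_real y)) ` {y1..1} \<union> (\<lambda>y. X_minus p (of_real y)) ` {y1..1}"

definition G_domain :: "(int \<Rightarrow> int \<Rightarrow> real) \<Rightarrow> real \<Rightarrow> complex set" where
  "G_domain p y1 = inside (boundary_curve p y1)"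

definition theta :: "(int \<Rightarrow> int \<Rightarrow> real) \<Rightarrow> real" where
  "theta p = arccos (- (\<Sum>i\<in>steps. \<Sum>j\<in>steps. of_int (i * j) * p i j) /
     (sqrt (\<Sum>i\<in>steps. \<Sum>j\<in>steps. of_int (i\<^sup>2) * p i j) *
      sqrt (\<Sum>i\<in>steps. \<Sum>j\<in>steps. of_int (j\<^sup>2) * p i j)))"

definition solves_bvp :: "(int \<Rightarrow> int \<Rightarrow> real) \<Rightarrow> real \<Rightarrow> (complex \<Rightarrow> complex) \<Rightarrow> bool" where
  "solves_bvp p y1 g \<longleftrightarrow>
     g holomorphic_on G_domain p y1 \<and>
     continuous_on (closure (G_domain p y1) - {1}) g \<and>
     (\<forall>y\<in>{y1..1}. g (X_plus p (of_real y)) = g (X_minus p (of_real y)))"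

text \<open>
  Near \<open>1\<close> the domain is a wedge around the segment to the left of \<open>1\<close>, bounded by the directions
  \<open>1 - r e\<^sup>\<plusminus>\<^sup>i\<^sup>\<theta>\<close>, so the principal branch of the power of \<open>1 - x\<close> is the relevant one.
  A conformal gluing function is a conformal map, hence injective with non-vanishing derivative.
\<close>

definition conformal_gluing :: "(int \<Rightarrow> int \<Rightarrow> real) \<Rightarrow> real \<Rightarrow> (complex \<Rightarrow> complex) \<Rightarrow> bool" where
  "conformal_gluing p y1 \<omega> \<longleftrightarrow>
     solves_bvp p y1 \<omega> \<and>
     inj_on \<omega> (G_domain p y1) \<and>
     (\<forall>x\<in>G_domain p y1. deriv \<omega> x \<noteq> 0) \<and>
     \<omega> 0 = 0 \<and>
     (\<exists>c. c \<noteq> 0 \<and>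
        ((\<lambda>x. \<omega> x * (1 - x) powr of_real (pi / theta p)) \<longlongrightarrow> c) (at 1 within G_domain p y1)) \<and>
     (\<forall>g. solves_bvp p y1 g \<longrightarrow>
        (\<exists>F. F holomorphic_on UNIV \<and> (\<forall>x\<in>closure (G_domain p y1) - {1}. g x = F (\<omega> x))))"

text \<open>
  Taylor expansion at \<open>0\<close> of a function that is only given on a set accumulating at \<open>0\<close>. This is
  needed because \<open>0\<close> lies on the boundary of the domain when \<open>p 0 1 = p 1 1 = 0\<close>.
\<close>

definition expands_at_0 :: "complex set \<Rightarrow> (complex \<Rightarrow> complex) \<Rightarrow> complex fps \<Rightarrow> bool" where
  "expands_at_0 S f F \<longleftrightarrow>
     0 islimpt S \<and> fps_conv_radius F > 0 \<and> (\<forall>\<^sub>F z in at 0 within S. f z = eval_fps F z)"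

text \<open>
  Formal power series in \<open>x\<close> and \<open>y\<close> are elements of \<^typ>\<open>complex fps fps\<close>, where \<open>y\<close> is the outer
  and \<open>x\<close> the inner variable.
\<close>

definition series_in_x :: "complex fps \<Rightarrow> complex fps fps" where
  "series_in_x A = fps_const A"

definition series_in_y :: "complex fps \<Rightarrow> complex fps fps" where
  "series_in_y B = Abs_fps (\<lambda>j. fps_const (fps_nth B j))"

definition gen_fun :: "(nat \<Rightarrow> nat \<Rightarrow> real) \<Rightarrow> complex fps fps" where
  "gen_fun h = Abs_fps (\<lambda>j. Abs_fps (\<lambda>i. of_real (h i j)))"

definition kernel :: "(int \<Rightarrow> int \<Rightarrow> real) \<Rightarrow> complex fps fps" where
  "kernel p =
     (\<Sum>i\<in>steps. \<Sum>j\<in>steps.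
        series_in_x (fps_const (of_real (p i j)) * fps_X ^ nat (1 - i)) *
        series_in_y (fps_X ^ nat (1 - j)))
     - series_in_x fps_X * series_in_y fps_X"

text \<open>
  The identity \<open>H(x,y) = (P(\<omega>(x)) - P(\<omega>(X\<^sub>+(y)))) / K(x,y)\<close>, where \<open>W\<close> and \<open>V\<close> are the expansions
  of \<open>\<omega>(x)\<close> and \<open>\<omega>(X\<^sub>+(y))\<close>. The kernel is a non-zero element of an integral domain but not a unit
  when \<open>p 1 1 = 0\<close>, so the quotient is expressed by a product.
\<close>

definition represented_by ::
  "(int \<Rightarrow> int \<Rightarrow> real) \<Rightarrow> complex fps \<Rightarrow> complex fps \<Rightarrow> (nat \<Rightarrow> nat \<Rightarrow> real) \<Rightarrow> complex fps \<Rightarrow> bool"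
where
  "represented_by p W V h P \<longleftrightarrow>
     gen_fun h * kernel p = series_in_x (P oo W) - series_in_y (P oo V)"

definition linear_iso_to_fps :: "(nat \<Rightarrow> nat \<Rightarrow> real) set \<Rightarrow> ((nat \<Rightarrow> nat \<Rightarrow> real) \<Rightarrow> real fps) \<Rightarrow> bool"
where
  "linear_iso_to_fps S \<phi> \<longleftrightarrow>
     bij_betw \<phi> S UNIV \<and>
     (\<forall>f\<in>S. \<forall>g\<in>S. \<phi> (\<lambda>i j. f i j + g i j) = \<phi> f + \<phi> g) \<and>
     (\<forall>c. \<forall>f\<in>S. \<phi> (\<lambda>i j. c * f i j) = fps_const c * \<phi> f)"

end

theory Submission
  imports Defs
begin

unbundle no vec_syntax

text \<open>
  The harmonicity equations say that \<open>H K\<close> has no monomial divisible by \<open>x y\<close>, that is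
  \<open>H K = A(x) + B(y)\<close>. If \<open>p\<^sub>1\<^sub>1 = 0\<close>, then \<open>A(0) = B(0) = 0\<close> and \<open>K\<close> vanishes at the origin with
  linear part \<open>p\<^sub>0\<^sub>1 x + p\<^sub>1\<^sub>0 y \<noteq> 0\<close>, so near the origin its zero set is a graph: \<open>x = X(y)\<close> with \<open>X = X\<^sub>+\<close>
  if \<open>p\<^sub>0\<^sub>1 > 0\<close>, and \<open>y = Y(x)\<close> if \<open>p\<^sub>1\<^sub>0 > 0\<close>. Substituting the graph gives \<open>B = - A \<circ> X\<close> or
  \<open>A = - B \<circ> Y\<close>, and \<open>P\<close> is obtained by composing \<open>A\<close> or \<open>- B\<close> with the inverse of a coordinate.

  If \<open>p\<^sub>0\<^sub>1 > 0\<close>, the point \<open>0\<close> lies in the interior of the domain and \<open>\<omega>\<close> itself is the coordinate. If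
  \<open>p\<^sub>0\<^sub>1 = 0\<close>, the boundary curve passes through \<open>0\<close>; there \<open>t = \<surd>(- y)\<close> is a local coordinate in
  which the domain is the right half-plane and the gluing condition identifies \<open>t\<close> with \<open>- t\<close> on the
  imaginary axis. Hence \<open>\<omega>\<close> continues to an even function of \<open>t\<close>, i.e. \<open>\<omega>(x) = g(Y(x))\<close> with \<open>g\<close> analytic
  at \<open>0\<close>, and injectivity of \<open>\<omega>\<close> forces \<open>g'(0) \<noteq> 0\<close>, so that \<open>g\<close> is the coordinate.

  The isomorphism with \<open>\<real>[[x]]\<close> needs no analysis and covers \<open>p\<^sub>1\<^sub>1 > 0\<close> as well: each equation
  \<open>\<Delta>h(i,j) = 0\<close> can be solved for one extreme value of \<open>h\<close>, and the values never solved for (a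
  countably infinite set) are free.
\<close>

section \<open>The kernel on the real axis\<close>

definition a_real :: "(int \<Rightarrow> int \<Rightarrow> real) \<Rightarrow> real \<Rightarrow> real" where
  "a_real p y = p (-1) 1 + p (-1) 0 * y + p (-1) (-1) * y\<^sup>2"

definition b_real :: "(int \<Rightarrow> int \<Rightarrow> real) \<Rightarrow> real \<Rightarrow> real" where
  "b_real p y = p 0 1 + (p 0 0 - 1) * y + p 0 (-1) * y\<^sup>2"

definition c_real :: "(int \<Rightarrow> int \<Rightarrow> real) \<Rightarrow> real \<Rightarrow> real" where
  "c_real p y = p 1 1 + p 1 0 * y + p 1 (-1) * y\<^sup>2"

definition discr_real :: "(int \<Rightarrow> int \<Rightarrow> real) \<Rightarrow> real \<Rightarrow> real" where
  "discr_real p y = (b_real p y)\<^sup>2 - 4 * a_real p y * c_real p y"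

lemma a_tilde_eq: "a_tilde p y = of_real (p (-1) 1) + of_real (p (-1) 0) * y + of_real (p (-1) (-1)) * y\<^sup>2"
  by (simp add: a_tilde_def)

lemma b_tilde_eq: "b_tilde p y = of_real (p 0 1) + of_real (p 0 0 - 1) * y + of_real (p 0 (-1)) * y\<^sup>2"
  by (simp add: b_tilde_def algebra_simps)

lemma c_tilde_eq: "c_tilde p y = of_real (p 1 1) + of_real (p 1 0) * y + of_real (p 1 (-1)) * y\<^sup>2"
  by (simp add: c_tilde_def)

lemma a_tilde_of_real: "a_tilde p (of_real y) = of_real (a_real p y)"
  by (simp add: a_tilde_eq a_real_def)

lemma b_tilde_of_real: "b_tilde p (of_real y) = of_real (b_real p y)"
  by (simp add: b_tilde_eq b_real_def)

lemma c_tilde_of_real: "c_tilde p (of_real y) = of_real (c_real p y)"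
  by (simp add: c_tilde_eq c_real_def)

lemma discr_of_real: "discr p (of_real y) = of_real (discr_real p y)"
  by (simp add: discr_def discr_real_def a_tilde_of_real b_tilde_of_real c_tilde_of_real)

text \<open>The quadratic that remains when the double root at 1 is divided out of the discriminant.
  Its three terms come from \<open>b = s (y-1)^2 - a - c\<close> and \<open>a - c = (y-1) e\<close>,
  inserted into \<open>b^2 - 4 a c\<close>.\<close>

definition discr_cofactor :: "(int \<Rightarrow> int \<Rightarrow> real) \<Rightarrow> real \<Rightarrow> real" where
  "discr_cofactor p y =
     (p (-1) 1 + p 0 1 + p 1 1)\<^sup>2 * (y - 1)\<^sup>2
     - 2 * (p (-1) 1 + p 0 1 + p 1 1) * (a_real p y + c_real p y)
     + ((p (-1) (-1) - p 1 (-1)) * y + (p 1 1 - p (-1) 1))\<^sup>2"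

text \<open>Dividing out the root \<open>r\<close> leaves an affine factor \<open>l\<close>. The
  signs of \<open>q\<close> at -1 and 1 make \<open>l\<close> negative at both ends, hence on the
  whole interval, so \<open>q\<close> changes sign only at \<open>r\<close>.\<close>

lemma quadratic_root_sign:
  fixes q :: "real \<Rightarrow> real"
  assumes q: "\<And>y. q y = \<alpha> * y\<^sup>2 + \<beta> * y + \<gamma>" and "q (-1) > 0" "q 1 < 0"
    and r: "q r = 0" "-1 \<le> r" "r < 1" and y: "-1 \<le> y" "y \<le> 1"
  shows "q y < 0 \<longleftrightarrow> r < y" "q y > 0 \<longleftrightarrow> y < r"
proof -
  define l where "l y = \<alpha> * y + (\<alpha> * r + \<beta>)" for y
  have ql: "q y = (y - r) * l y" for y
    using q[of r] r(1) unfolding q[of y] l_def by (simp add: power2_eq_square algebra_simps)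
  have "l 1 < 0" using ql[of 1] assms(3) r(3) by (simp add: mult_less_0_iff)
  moreover have "l (-1) < 0"
    using ql[of "-1"] assms(2) r(2) by (simp add: zero_less_mult_iff)
  ultimately have "l y < 0"
  proof -
    assume l: "l 1 < 0" "l (-1) < 0"
    have "l y = (1 + y) / 2 * l 1 + (1 - y) / 2 * l (-1)" by (simp add: l_def field_simps)
    moreover have "(1 + y) / 2 * l 1 \<le> 0" "(1 - y) / 2 * l (-1) \<le> 0"
      using l y by (simp_all add: mult_nonneg_nonpos)
    moreover have "(1 + y) / 2 * l 1 < 0 \<or> (1 - y) / 2 * l (-1) < 0"
      using l y by (simp add: mult_less_0_iff) linarith
    ultimately show ?thesis by linarith
  qed
  then show "q y < 0 \<longleftrightarrow> r < y" "q y > 0 \<longleftrightarrow> y < r"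
    by (auto simp: ql mult_less_0_iff zero_less_mult_iff)
qed

section \<open>Factorization of the discriminant and its signs at the ends of [-1,1]\<close>

locale walk =
  fixes p :: "int \<Rightarrow> int \<Rightarrow> real"
  assumes probabilities: "transition_probabilities p"
    and nondegenerate: "nondegenerate p"
    and zero_drift: "zero_drift p"
begin

lemma nonneg: "p (-1) (-1) \<ge> 0" "p (-1) 0 \<ge> 0" "p (-1) 1 \<ge> 0" "p 0 (-1) \<ge> 0" "p 0 0 \<ge> 0"
    "p 0 1 \<ge> 0" "p 1 (-1) \<ge> 0" "p 1 0 \<ge> 0" "p 1 1 \<ge> 0"
  using probabilities by (auto simp: transition_probabilities_def)

lemma total: "p (-1) (-1) + p (-1) 0 + p (-1) 1 + p 0 (-1) + p 0 0 + p 0 1 + p 1 (-1) + p 1 0 + p 1 1 = 1"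
  using probabilities by (simp add: transition_probabilities_def)

lemma drift_x: "p (-1) (-1) + p (-1) 0 + p (-1) 1 = p 1 (-1) + p 1 0 + p 1 1"
  and drift_y: "p (-1) (-1) + p 0 (-1) + p 1 (-1) = p (-1) 1 + p 0 1 + p 1 1"
  using zero_drift by (auto simp: zero_drift_def)

lemma no_three_zeros:
  "\<not> (p 1 1 = 0 \<and> p 1 0 = 0 \<and> p 1 (-1) = 0)"
  "\<not> (p 1 0 = 0 \<and> p 1 (-1) = 0 \<and> p 0 (-1) = 0)"
  "\<not> (p 1 (-1) = 0 \<and> p 0 (-1) = 0 \<and> p (-1) (-1) = 0)"
  "\<not> (p 0 (-1) = 0 \<and> p (-1) (-1) = 0 \<and> p (-1) 0 = 0)"
  "\<not> (p (-1) (-1) = 0 \<and> p (-1) 0 = 0 \<and> p (-1) 1 = 0)"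
  "\<not> (p (-1) 0 = 0 \<and> p (-1) 1 = 0 \<and> p 0 1 = 0)"
  "\<not> (p (-1) 1 = 0 \<and> p 0 1 = 0 \<and> p 1 1 = 0)"
  "\<not> (p 0 1 = 0 \<and> p 1 1 = 0 \<and> p 1 0 = 0)"
proof -
  let ?L = "[p 1 1, p 1 0, p 1 (-1), p 0 (-1), p (-1) (-1), p (-1) 0, p (-1) 1, p 0 1]"
  have *: "\<not> (?L ! k = 0 \<and> ?L ! ((k + 1) mod 8) = 0 \<and> ?L ! ((k + 2) mod 8) = 0)" if "k < 8" for k
    using nondegenerate that unfolding nondegenerate_def Let_def by blast
  show "\<not> (p 1 1 = 0 \<and> p 1 0 = 0 \<and> p 1 (-1) = 0)" using *[of 0] by (simp add: numeral_2_eq_2)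
  show "\<not> (p 1 0 = 0 \<and> p 1 (-1) = 0 \<and> p 0 (-1) = 0)" using *[of 1] by simp
  show "\<not> (p 1 (-1) = 0 \<and> p 0 (-1) = 0 \<and> p (-1) (-1) = 0)" using *[of 2] by simp
  show "\<not> (p 0 (-1) = 0 \<and> p (-1) (-1) = 0 \<and> p (-1) 0 = 0)" using *[of 3] by simp
  show "\<not> (p (-1) (-1) = 0 \<and> p (-1) 0 = 0 \<and> p (-1) 1 = 0)" using *[of 4] by simp
  show "\<not> (p (-1) 0 = 0 \<and> p (-1) 1 = 0 \<and> p 0 1 = 0)" using *[of 5] by simp
  show "\<not> (p (-1) 1 = 0 \<and> p 0 1 = 0 \<and> p 1 1 = 0)" using *[of 6] by simp
  show "\<not> (p 0 1 = 0 \<and> p 1 1 = 0 \<and> p 1 0 = 0)" using *[of 7] by simp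
qed

lemma discr_real_factor: "discr_real p y = (1 - y)\<^sup>2 * discr_cofactor p y"
proof -
  define s where "s = p (-1) 1 + p 0 1 + p 1 1"
  define e where "e = (p (-1) (-1) - p 1 (-1)) * y + (p 1 1 - p (-1) 1)"
  \<comment> \<open>This is \<open>K(1,y) = s (y-1)^2\<close>: value and derivative vanish at 1
    because the probabilities sum to 1 and the vertical drift is 0.\<close>
  have b: "b_real p y = s * (y - 1)\<^sup>2 - a_real p y - c_real p y"
  proof -
    have 1: "p 0 0 - 1 = - 2 * s - p (-1) 0 - p 1 0"
      and 2: "p 0 (-1) = s - p (-1) (-1) - p 1 (-1)"
      using total drift_y by (simp_all add: s_def)
    show ?thesis
      unfolding b_real_def 1 2 a_real_def c_real_def by (simp add: s_def power2_eq_square algebra_simps)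
  qed
  \<comment> \<open>The horizontal drift is the value of \<open>a - c\<close> at 1.\<close>
  have ac: "a_real p y - c_real p y = (y - 1) * e"
  proof -
    have 1: "p (-1) 0 = p 1 (-1) + p 1 0 + p 1 1 - p (-1) (-1) - p (-1) 1"
      using drift_x by simp
    show ?thesis
      unfolding a_real_def c_real_def e_def 1 by (simp add: power2_eq_square algebra_simps)
  qed
  have "discr_real p y = (s * (y - 1)\<^sup>2)\<^sup>2 - 2 * (s * (y - 1)\<^sup>2) * (a_real p y + c_real p y)
          + (a_real p y - c_real p y)\<^sup>2"
    unfolding discr_real_def b by (simp add: power2_eq_square algebra_simps)
  also have "\<dots> = (1 - y)\<^sup>2 * (s\<^sup>2 * (y - 1)\<^sup>2 - 2 * s * (a_real p y + c_real p y) + e\<^sup>2)"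
    unfolding ac by (simp add: power2_eq_square algebra_simps)
  finally show ?thesis by (simp add: discr_cofactor_def s_def e_def)
qed

text \<open>At \<open>y = 1\<close> the cofactor is \<open>E(ij)\<^sup>2 - E(i\<^sup>2) E(j\<^sup>2)\<close>, so this is a strict Cauchy--Schwarz inequality.\<close>

lemma discr_cofactor_1: "discr_cofactor p 1 < 0"
proof -
  define u where "u = p 1 1 + p (-1) (-1)"
  define v where "v = p 1 (-1) + p (-1) 1"
  define w where "w = p 1 0 + p (-1) 0"
  define z where "z = p 0 1 + p 0 (-1)"
  have nn: "u \<ge> 0" "v \<ge> 0" "w \<ge> 0" "z \<ge> 0"
    using nonneg by (auto simp: u_def v_def w_def z_def)
  have ac: "a_real p 1 + c_real p 1 = u + v + w"
    by (simp add: a_real_def c_real_def u_def v_def w_def)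
  have s: "2 * (p (-1) 1 + p 0 1 + p 1 1) = u + v + z"
    using drift_y by (simp add: u_def v_def z_def)
  have "discr_cofactor p 1 = - ((u + v + z) * (u + v + w)) + (u - v)\<^sup>2"
    unfolding discr_cofactor_def ac s[symmetric] by (simp add: u_def v_def algebra_simps)
  also have "\<dots> = - (4 * (u * v) + u * w + v * w + u * z + v * z + w * z)"
    by (simp add: power2_eq_square algebra_simps)
  finally have eq: "discr_cofactor p 1 = - (4 * (u * v) + u * w + v * w + u * z + v * z + w * z)" .
  \<comment> \<open>Each of \<open>u\<close>, \<open>v\<close>, \<open>w\<close>, \<open>z\<close>
    is a sum over a pair of opposite steps. If all products vanish, three of the four sums vanish,
    and any three of them contain three consecutive zeros of the cyclic list.\<close>
  have "u * v > 0 \<or> u * w > 0 \<or> v * w > 0 \<or> u * z > 0 \<or> v * z > 0 \<or> w * z > 0"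
  proof (rule ccontr)
    assume "\<not> ?thesis"
    then have "\<not> (u > 0 \<and> v > 0)" "\<not> (u > 0 \<and> w > 0)" "\<not> (v > 0 \<and> w > 0)" "\<not> (u > 0 \<and> z > 0)"
      "\<not> (v > 0 \<and> z > 0)" "\<not> (w > 0 \<and> z > 0)"
      by auto
    with nn have "(u = 0 \<and> v = 0 \<and> w = 0) \<or> (u = 0 \<and> v = 0 \<and> z = 0) \<or> (u = 0 \<and> w = 0 \<and> z = 0)
       \<or> (v = 0 \<and> w = 0 \<and> z = 0)"
      by linarith
    moreover have "u = 0 \<Longrightarrow> p 1 1 = 0 \<and> p (-1) (-1) = 0" "v = 0 \<Longrightarrow> p 1 (-1) = 0 \<and> p (-1) 1 = 0"
      "w = 0 \<Longrightarrow> p 1 0 = 0 \<and> p (-1) 0 = 0" "z = 0 \<Longrightarrow> p 0 1 = 0 \<and> p 0 (-1) = 0"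
      using nonneg by (auto simp: u_def v_def w_def z_def)
    ultimately show False using no_three_zeros by metis
  qed
  moreover have "u * v \<ge> 0" "u * w \<ge> 0" "v * w \<ge> 0" "u * z \<ge> 0" "v * z \<ge> 0" "w * z \<ge> 0"
    using nn by simp_all
  ultimately show ?thesis unfolding eq by linarith
qed

text \<open>With \<open>A\<close> the probability of a step to the right (equal to that of a step to
  the left), \<open>\<bar>a\<bar>\<close> and \<open>\<bar>c\<bar>\<close> are at most
  \<open>A\<close> while \<open>b\<close> is at least \<open>2 A\<close>. Strictness comes from
  \<open>p 0 1 > 0\<close>, or else from \<open>p 1 0 > 0\<close> and
  \<open>p (-1) 1 > 0\<close>.\<close>

lemma discr_cofactor_minus_1:
  assumes p11: "p 1 1 = 0"
  shows "discr_cofactor p (-1) > 0"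
proof -
  define A where "A = p 1 (-1) + p 1 0"
  define a where "a = a_real p (-1)"
  define b where "b = b_real p (-1)"
  define c where "c = c_real p (-1)"
  have a_eq: "a = p (-1) 1 - p (-1) 0 + p (-1) (-1)" and b_eq: "b = p 0 1 + 1 - p 0 0 + p 0 (-1)"
    and c_eq: "c = p 1 (-1) - p 1 0"
    by (simp_all add: a_def b_def c_def a_real_def b_real_def c_real_def p11)
  have A: "A > 0" using no_three_zeros(1) nonneg p11 unfolding A_def by linarith
  have a: "\<bar>a\<bar> \<le> A" and c: "\<bar>c\<bar> \<le> A"
    using nonneg drift_x p11 unfolding a_eq c_eq A_def by linarith+
  have b: "b = 2 * A + 2 * p 0 1 + 2 * p 0 (-1)"
    using total drift_x p11 unfolding b_eq A_def by (simp add: algebra_simps)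
  have "4 * (a * c) < b\<^sup>2"
  proof (cases "p 0 1 > 0")
    case True
    then have "2 * A < b" using b nonneg by linarith
    then have "(2 * A)\<^sup>2 < b\<^sup>2" using A by (intro power_strict_mono) auto
    moreover have "a * c \<le> A * A"
      using mult_mono[OF a c] A abs_le_D1[of "a * c" "A * A"] by (simp add: abs_mult)
    ultimately show ?thesis by (simp add: power2_eq_square)
  next
    case False
    then have p01: "p 0 1 = 0" using nonneg by linarith
    have p10: "p 1 0 > 0" and pm: "p (-1) 1 > 0"
      using no_three_zeros(7,8) nonneg p01 p11 by (metis less_eq_real_def)+
    have "a * c < A * A"
    \<comment> \<open>If \<open>p 1 (-1) = 0\<close>, then \<open>c\<close> is extremal and
      strictness must come from \<open>a\<close>; otherwise the two terms of \<open>c\<close> cancel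
      partly and \<open>\<bar>c\<bar> < A\<close>.\<close>
    proof (cases "p 1 (-1) = 0")
      case True
      then have cA: "c = - A" by (simp add: c_eq A_def)
      have "- a < A" using nonneg drift_x p11 pm unfolding a_eq A_def by linarith
      then show ?thesis using A mult_strict_right_mono[of "- a" A A] by (simp add: cA)
    next
      case False
      then have "\<bar>c\<bar> < A" using p10 nonneg unfolding c_eq A_def by (simp add: abs_if)
      then have "A * \<bar>c\<bar> < A * A" using A by simp
      moreover have "a * c \<le> \<bar>a\<bar> * \<bar>c\<bar>" by (metis abs_ge_self abs_mult)
      moreover have "\<bar>a\<bar> * \<bar>c\<bar> \<le> A * \<bar>c\<bar>" using a by (simp add: mult_right_mono)
      ultimately show ?thesis by linarith
    qed
    moreover have "(2 * A)\<^sup>2 \<le> b\<^sup>2" using b nonneg A by (intro power_mono) auto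
    ultimately show ?thesis by (simp add: power2_eq_square)
  qed
  then have "discr_real p (-1) > 0" by (simp add: discr_real_def a_def b_def c_def)
  then show ?thesis using discr_real_factor[of "-1"] by simp
qed

end

section \<open>Position of the branch point \<open>y1\<close>\<close>

locale branch_walk = walk +
  fixes y1 :: real
  assumes p11: "p 1 1 = 0"
    and y1: "y1 \<in> {-1..<1}"
    and discr_y1: "discr p (of_real y1) = 0"
begin

text \<open>The cofactor is a quadratic vanishing at \<open>y1\<close>, so
  \<open>quadratic_root_sign\<close> applies. This is what makes \<open>X_plus\<close> and
  \<open>X_minus\<close> complex conjugate on [y1,1].\<close>

lemma discr_cofactor_sign:
  assumes "-1 \<le> y" "y \<le> 1"
  shows "discr_cofactor p y < 0 \<longleftrightarrow> y1 < y" "discr_cofactor p y > 0 \<longleftrightarrow> y < y1"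
proof -
  define s where "s = p (-1) 1 + p 0 1 + p 1 1"
  define e where "e = p (-1) (-1) - p 1 (-1)"
  define d where "d = p 1 1 - p (-1) 1"
  have q: "discr_cofactor p y = (s\<^sup>2 - 2 * s * (p (-1) (-1) + p 1 (-1)) + e\<^sup>2) * y\<^sup>2
     + (- 2 * s\<^sup>2 - 2 * s * (p (-1) 0 + p 1 0) + 2 * e * d) * y
     + (s\<^sup>2 - 2 * s * (p (-1) 1 + p 1 1) + d\<^sup>2)" for y
    unfolding discr_cofactor_def a_real_def c_real_def s_def[symmetric] e_def[symmetric] d_def[symmetric]
    by (simp add: power2_eq_square algebra_simps)
  have "discr_cofactor p y1 = 0"
    using discr_y1 y1 discr_real_factor[of y1] by (simp add: discr_of_real)
  from quadratic_root_sign[OF q discr_cofactor_minus_1[OF p11] discr_cofactor_1 this _ _ assms] y1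
  show "discr_cofactor p y < 0 \<longleftrightarrow> y1 < y" "discr_cofactor p y > 0 \<longleftrightarrow> y < y1"
    by auto
qed

lemma discr_real_neg: "y1 < y \<Longrightarrow> y < 1 \<Longrightarrow> discr_real p y < 0"
  using discr_cofactor_sign(1)[of y] y1 by (simp add: discr_real_factor mult_less_0_iff)

lemma discr_real_ends: "discr_real p y1 = 0" "discr_real p 1 = 0"
  using discr_y1 by (simp_all add: discr_of_real discr_real_factor)

lemma discr_real_0: "discr_real p 0 = (p 0 1)\<^sup>2"
  by (simp add: discr_real_def a_real_def b_real_def c_real_def p11)

text \<open>The discriminant at 0 is \<open>(p 0 1)^2\<close>, and its sign locates 0 relative to
  the branch point. This decides whether the origin is an interior point of the domain or lies on
  its boundary curve.\<close>

lemma y1_pos: "p 0 1 > 0 \<Longrightarrow> y1 > 0"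
  using discr_cofactor_sign(2)[of 0] discr_real_0 discr_real_factor[of 0] by simp

lemma y1_eq_0: "p 0 1 = 0 \<Longrightarrow> y1 = 0"
  using discr_cofactor_sign[of 0] discr_real_0 discr_real_factor[of 0] by simp

lemma y1_nonneg: "y1 \<ge> 0"
  using y1_pos y1_eq_0 nonneg(6) by fastforce

lemma a_real_pos: "y > 0 \<Longrightarrow> a_real p y > 0"
  using no_three_zeros(5) nonneg unfolding a_real_def
  by (smt (verit) mult_pos_pos mult_nonneg_nonneg zero_less_power)

lemma a_real_pos_on: "y1 \<le> y \<Longrightarrow> a_real p y > 0"
proof (cases "y = 0")
  case True
  assume "y1 \<le> y"
  with True y1_pos nonneg(6) have "p 0 1 = 0" by fastforce
  then have "p (-1) 1 > 0" using no_three_zeros(7) p11 nonneg(3) by linarith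
  then show ?thesis by (simp add: True a_real_def)
next
  case False
  assume "y1 \<le> y"
  then show ?thesis using False y1_nonneg by (intro a_real_pos) linarith
qed

lemma c_real_pos: "y > 0 \<Longrightarrow> c_real p y > 0"
  using no_three_zeros(1) nonneg p11 unfolding c_real_def
  by (smt (verit) mult_pos_pos mult_nonneg_nonneg zero_less_power)

lemma discr_real_nonneg: "0 \<le> y \<Longrightarrow> y \<le> y1 \<Longrightarrow> discr_real p y \<ge> 0"
  using discr_cofactor_sign[of y] y1 by (simp add: discr_real_factor)

text \<open>Otherwise \<open>b_real\<close> would have a zero in (0,y1], where the discriminant
  \<open>- 4 a c\<close> would be negative although it is nonnegative up to \<open>y1\<close>. The
  positivity puts the left real point of the boundary curve below 0.\<close>

lemma b_real_y1_pos:
  assumes "p 0 1 > 0"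
  shows "b_real p y1 > 0"
proof (rule ccontr)
  assume "\<not> ?thesis"
  moreover have "b_real p 0 \<ge> 0" using assms by (simp add: b_real_def)
  moreover have "isCont (b_real p) y" for y
    unfolding b_real_def by (intro continuous_intros)
  ultimately obtain y where y: "0 \<le> y" "y \<le> y1" "b_real p y = 0"
    using IVT2[of "b_real p" y1 0 0] y1_nonneg by auto
  then have "y \<noteq> 0" using assms by (auto simp: b_real_def)
  then have "a_real p y * c_real p y > 0" using y a_real_pos c_real_pos by simp
  with discr_real_nonneg[OF y(1,2)] y(3) show False by (simp add: discr_real_def)
qed

end

section \<open>Harmonic functions and their free boundary data\<close>

text \<open>Equation \<open>s\<close> has the coefficient \<open>c\<close> at the position
  \<open>piv s\<close> and otherwise involves only positions that are smaller in \<open>r\<close>.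
  Well-founded recursion therefore solves the equations one pivot at a time, and the values off the
  pivots are free.\<close>

lemma pivot_recursion_ex1:
  fixes L :: "('a \<Rightarrow> real) \<Rightarrow> 'b \<Rightarrow> real"
  assumes wf: "wf r" and inj: "inj piv" and c: "c \<noteq> 0"
    and dep: "\<And>h h' s. (\<And>z. (z, piv s) \<in> r \<Longrightarrow> h z = h' z) \<Longrightarrow>
                 L h s - c * h (piv s) = L h' s - c * h' (piv s)"
  shows "\<exists>!h. (\<forall>s. L h s = 0) \<and> (\<forall>z. z \<notin> range piv \<longrightarrow> h z = u z)"
proof (rule ex_ex1I)
  \<comment> \<open>On a pivot this solves equation \<open>s\<close> for its pivot value. The value
    of \<open>h\<close> at the pivot cancels in \<open>c * h z - L h\<close>, so
    \<open>F h z\<close> depends only on smaller positions.\<close>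
  define F where "F h z = (if z \<in> range piv
      then (c * h z - L h (inv piv z)) / c else u z)" for h :: "'a \<Rightarrow> real" and z
  have Fpiv: "F h (piv s) = (c * h (piv s) - L h s) / c" for h s
    using inj by (simp add: F_def)
  have "adm_wf r F"
    unfolding adm_wf_def
  proof (intro allI impI)
    fix h h' :: "'a \<Rightarrow> real" and z assume *: "\<forall>w. (w, z) \<in> r \<longrightarrow> h w = h' w"
    show "F h z = F h' z"
    proof (cases "z \<in> range piv")
      case True
      then obtain s where s: "z = piv s" by auto
      have "L h s - c * h (piv s) = L h' s - c * h' (piv s)"
        using * s by (intro dep) auto
      then show ?thesis unfolding s Fpiv by simp
    qed (simp add: F_def)
  qed
  then have fix_eq: "wfrec r F = F (wfrec r F)"
    using wf wfrec_fixpoint by blast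
  show "\<exists>h. (\<forall>s. L h s = 0) \<and> (\<forall>z. z \<notin> range piv \<longrightarrow> h z = u z)"
  proof (intro exI[of _ "wfrec r F"] conjI allI impI)
    fix s
    have "wfrec r F (piv s) = (c * wfrec r F (piv s) - L (wfrec r F) s) / c"
      using fix_eq Fpiv by metis
    then show "L (wfrec r F) s = 0" using c by (simp add: field_simps)
  next
    fix z assume "z \<notin> range piv"
    then show "wfrec r F z = u z" using fun_cong[OF fix_eq, of z] by (simp add: F_def)
  qed
next
  fix h h' assume h: "(\<forall>s. L h s = 0) \<and> (\<forall>z. z \<notin> range piv \<longrightarrow> h z = u z)"
    and h': "(\<forall>s. L h' s = 0) \<and> (\<forall>z. z \<notin> range piv \<longrightarrow> h' z = u z)"
  show "h = h'"
  proof
    fix z show "h z = h' z"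
      using wf
    proof (induction z rule: wf_induct_rule)
      case (less z)
      show ?case
      proof (cases "z \<in> range piv")
        case True
        then obtain s where s: "z = piv s" by auto
        have "L h s - c * h (piv s) = L h' s - c * h' (piv s)"
          using less s by (intro dep) auto
        then show ?thesis using h h' c s by simp
      qed (use h h' in auto)
    qed
  qed
qed

text \<open>A harmonic function is determined by its values off the pivots, and these are arbitrary.
  Enumerating the countably infinite set of such positions turns the values into the coefficients of
  a power series.\<close>

lemma linear_iso_from_pivot:
  assumes "wf r" and "inj piv" and "c \<noteq> 0"
    and inf: "infinite (- range piv)"
    and dep: "\<And>h h' i j. (\<And>k l. ((k, l), piv (i, j)) \<in> r \<Longrightarrow> h k l = h' k l) \<Longrightarrow>
       laplacian p h i j - c * case_prod h (piv (i, j)) = laplacian p h' i j - c * case_prod h' (piv (i, j))"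
  shows "\<exists>\<phi>. linear_iso_to_fps (harmonic_functions p) \<phi>"
proof -
  define D :: "(nat \<times> nat) set" where "D = - range piv"
  define e where "e = from_nat_into D"
  have e: "bij_betw e UNIV D"
    using inf unfolding e_def D_def by (intro bij_betw_from_nat_into) auto
  define \<phi> where "\<phi> h = Abs_fps (\<lambda>n. case_prod h (e n))" for h :: "nat \<Rightarrow> nat \<Rightarrow> real"
  define L where "L h s = laplacian p (curry h) (fst s) (snd s)" for h :: "nat \<times> nat \<Rightarrow> real" and s
  have ex1: "\<exists>!h. (\<forall>s. L h s = 0) \<and> (\<forall>z. z \<notin> range piv \<longrightarrow> h z = u z)" for u
  proof (rule pivot_recursion_ex1[OF assms(1-3)])
    fix h h' :: "nat \<times> nat \<Rightarrow> real" and s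
    assume "\<And>z. (z, piv s) \<in> r \<Longrightarrow> h z = h' z"
    then show "L h s - c * h (piv s) = L h' s - c * h' (piv s)"
      using dep[of "fst s" "snd s" "curry h" "curry h'"] by (simp add: L_def)
  qed
  have L_harm: "(\<forall>s. L h s = 0) \<longleftrightarrow> curry h \<in> harmonic_functions p" for h
    by (auto simp: L_def harmonic_functions_def)
  have "inj_on \<phi> (harmonic_functions p)"
  proof (rule inj_onI)
    fix h h' assume h: "h \<in> harmonic_functions p" "h' \<in> harmonic_functions p" "\<phi> h = \<phi> h'"
    have "case_prod h (e n) = case_prod h' (e n)" for n
      using h(3) by (auto simp: \<phi>_def fps_eq_iff)
    then have "\<forall>z. z \<notin> range piv \<longrightarrow> case_prod h z = case_prod h' z"
      using bij_betw_imp_surj_on[OF e] unfolding D_def by (metis ComplI imageE)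
    then have "case_prod h = case_prod h'"
      using ex1[of "case_prod h'"] h(1,2) L_harm[of "case_prod h"] L_harm[of "case_prod h'"] by auto
    then show "h = h'" by (metis curry_case_prod)
  qed
  moreover have "\<exists>h\<in>harmonic_functions p. P = \<phi> h" for P
  proof -
    obtain h where h: "\<forall>s. L h s = 0" "\<forall>z. z \<notin> range piv \<longrightarrow> h z = fps_nth P (inv_into UNIV e z)"
      using ex1[of "\<lambda>z. fps_nth P (inv_into UNIV e z)"] by blast
    have "h (e n) = fps_nth P n" for n
    proof -
      have "e n \<notin> range piv" using bij_betw_imp_surj_on[OF e] by (auto simp: D_def)
      moreover have "inv_into UNIV e (e n) = n" using e by (simp add: bij_betw_def)
      ultimately show ?thesis using h(2)[rule_format, of "e n"] by simp
    qed
    then have "\<phi> (curry h) = P" by (simp add: \<phi>_def fps_eq_iff)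
    then show ?thesis using h(1) L_harm by blast
  qed
  ultimately have "bij_betw \<phi> (harmonic_functions p) UNIV"
    unfolding bij_betw_def by (auto simp: image_iff set_eq_iff)
  then have "linear_iso_to_fps (harmonic_functions p) \<phi>"
    unfolding linear_iso_to_fps_def
    by (auto simp: \<phi>_def fps_eq_iff split: prod.splits)
  then show ?thesis by blast
qed

section \<open>The choice of pivots for the Laplacian\<close>

lemma laplacian_eq:
  "laplacian p f i j =
     p (-1) (-1) * (if i = 0 \<or> j = 0 then 0 else f (i - 1) (j - 1))
     + p (-1) 0 * (if i = 0 then 0 else f (i - 1) j)
     + p (-1) 1 * (if i = 0 then 0 else f (i - 1) (Suc j))
     + p 0 (-1) * (if j = 0 then 0 else f i (j - 1)) + p 0 0 * f i j + p 0 1 * f i (Suc j)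
     + p 1 (-1) * (if j = 0 then 0 else f (Suc i) (j - 1)) + p 1 0 * f (Suc i) j
     + p 1 1 * f (Suc i) (Suc j) - f i j"
  by (cases i; cases j) (simp_all add: laplacian_def extend_by_0_def nat_add_distrib)

context walk
begin

text \<open>The pivot of the equation at (i,j) is its north-east, north or east neighbour, the first
  of these with positive probability. The free values are those on both axes, on the horizontal
  axis, or on the vertical axis, respectively.\<close>

lemma ex_linear_iso: "\<exists>\<phi>. linear_iso_to_fps (harmonic_functions p) \<phi>"
proof -
  \<comment> \<open>\<open>r1\<close> orders the points by rows first and \<open>r2\<close> by
    columns first. In the second case the pivot is the last entry of the row \<open>j + 1\<close> in
    its equation, in the third case the last entry of the column \<open>i + 1\<close>.\<close>
  define r1 where "r1 = inv_image (less_than <*lex*> less_than) (\<lambda>(i, j). (j, i :: nat) :: nat \<times> nat)"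
  define r2 where "r2 = (less_than <*lex*> less_than :: ((nat \<times> nat) \<times> (nat \<times> nat)) set)"
  have wf: "wf r1" "wf r2" unfolding r1_def r2_def by auto
  consider "p 1 1 > 0" | "p 1 1 = 0" "p 0 1 > 0" | "p 1 1 = 0" "p 0 1 = 0" "p 1 0 > 0"
    using nonneg(6,8,9) no_three_zeros(8) by linarith
  then show ?thesis
  proof cases
    case 1
    define piv where "piv = (\<lambda>(i, j). (Suc i, Suc j))"
    have "infinite (- range piv)"
    proof
      assume "finite (- range piv)"
      moreover have "range (\<lambda>i. (i, 0)) \<subseteq> - range piv" by (auto simp: piv_def)
      ultimately have "finite (range (\<lambda>i::nat. (i, 0::nat)))" by (rule rev_finite_subset)
      then show False by (auto simp: finite_image_iff inj_on_def)
    qed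
    note inf = this
    show ?thesis
    proof (rule linear_iso_from_pivot[OF wf(1) _ less_imp_neq[OF 1, symmetric] inf])
      show "inj piv" by (auto simp: piv_def inj_on_def)
      fix h h' :: "nat \<Rightarrow> nat \<Rightarrow> real" and i j
      assume h: "\<And>k l. ((k, l), piv (i, j)) \<in> r1 \<Longrightarrow> h k l = h' k l"
      have "h k l = h' k l" if "l < Suc j \<or> l = Suc j \<and> k < Suc i" for k l
        using that by (intro h) (auto simp: piv_def r1_def)
      then have "h k l = h' k l" if "l \<le> j \<or> l = Suc j \<and> k \<le> i" for k l
        using that by auto
      then show "laplacian p h i j - p 1 1 * case_prod h (piv (i, j)) =
          laplacian p h' i j - p 1 1 * case_prod h' (piv (i, j))"
        unfolding piv_def laplacian_eq by auto
    qed
  next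
    case 2
    define piv where "piv = (\<lambda>(i, j). (i :: nat, Suc j))"
    have "infinite (- range piv)"
    proof
      assume "finite (- range piv)"
      moreover have "range (\<lambda>i. (i, 0)) \<subseteq> - range piv" by (auto simp: piv_def)
      ultimately have "finite (range (\<lambda>i::nat. (i, 0::nat)))" by (rule rev_finite_subset)
      then show False by (auto simp: finite_image_iff inj_on_def)
    qed
    note inf = this
    show ?thesis
    proof (rule linear_iso_from_pivot[OF wf(1) _ less_imp_neq[OF 2(2), symmetric] inf])
      show "inj piv" by (auto simp: piv_def inj_on_def)
      fix h h' :: "nat \<Rightarrow> nat \<Rightarrow> real" and i j
      assume h: "\<And>k l. ((k, l), piv (i, j)) \<in> r1 \<Longrightarrow> h k l = h' k l"
      have "h k l = h' k l" if "l \<le> j \<or> l = Suc j \<and> k < i" for k l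
        using that by (intro h) (auto simp: piv_def r1_def)
      then show "laplacian p h i j - p 0 1 * case_prod h (piv (i, j)) =
          laplacian p h' i j - p 0 1 * case_prod h' (piv (i, j))"
        unfolding piv_def laplacian_eq using 2(1) by auto
    qed
  next
    case 3
    define piv where "piv = (\<lambda>(i, j). (Suc i, j :: nat))"
    have "infinite (- range piv)"
    proof
      assume "finite (- range piv)"
      moreover have "range (\<lambda>j. (0, j)) \<subseteq> - range piv" by (auto simp: piv_def)
      ultimately have "finite (range (\<lambda>j::nat. (0::nat, j)))" by (rule rev_finite_subset)
      then show False by (auto simp: finite_image_iff inj_on_def)
    qed
    note inf = this
    show ?thesis
    proof (rule linear_iso_from_pivot[OF wf(2) _ less_imp_neq[OF 3(3), symmetric] inf])
      show "inj piv" by (auto simp: piv_def inj_on_def)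
      fix h h' :: "nat \<Rightarrow> nat \<Rightarrow> real" and i j
      assume h: "\<And>k l. ((k, l), piv (i, j)) \<in> r2 \<Longrightarrow> h k l = h' k l"
      have "h k l = h' k l" if "k \<le> i \<or> k = Suc i \<and> l < j" for k l
        using that by (intro h) (auto simp: piv_def r2_def)
      then show "laplacian p h i j - p 1 0 * case_prod h (piv (i, j)) =
          laplacian p h' i j - p 1 0 * case_prod h' (piv (i, j))"
        unfolding piv_def laplacian_eq using 3(1) by auto
    qed
  qed
qed

end

section \<open>Formal power series\<close>

definition transpose_fps :: "'a::zero fps fps \<Rightarrow> 'a fps fps" where
  "transpose_fps F = Abs_fps (\<lambda>j. Abs_fps (\<lambda>i. F $ i $ j))"

lemma transpose_fps_nth [simp]: "transpose_fps F $ j $ i = F $ i $ j"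
  by (simp add: transpose_fps_def)

lemma transpose_fps_mult:
  fixes F G :: "'a::comm_ring_1 fps fps"
  shows "transpose_fps (F * G) = transpose_fps F * transpose_fps G"
proof (intro fps_ext)
  fix i j
  show "transpose_fps (F * G) $ i $ j = (transpose_fps F * transpose_fps G) $ i $ j"
    by (simp add: fps_mult_nth fps_sum_nth) (rule sum.swap)
qed

lemma transpose_fps_diff:
  "transpose_fps (F - G) = transpose_fps F - transpose_fps (G :: 'a::ab_group_add fps fps)"
  by (intro fps_ext) simp

lemma transpose_series_in_x: "transpose_fps (series_in_x A) = series_in_y A"
  and transpose_series_in_y: "transpose_fps (series_in_y A) = series_in_x A"
  by (intro fps_ext; simp add: series_in_x_def series_in_y_def)+

section \<open>Substitution of a series for y\<close>

text \<open>The series \<open>F(x, Y(x))\<close>. For \<open>Y\<close> without constant term,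
  \<open>Y ^ j\<close> starts in degree \<open>j\<close>, so a finite sum suffices for the
  coefficient \<open>n\<close>.\<close>

definition subst_y :: "complex fps \<Rightarrow> complex fps fps \<Rightarrow> complex fps" where
  "subst_y Y F = Abs_fps (\<lambda>n. (\<Sum>j\<le>n. F $ j * Y ^ j) $ n)"

lemma subst_y_nth:
  assumes Y: "Y $ 0 = 0" and "n \<le> N"
  shows "subst_y Y F $ n = (\<Sum>j\<le>N. F $ j * Y ^ j) $ n"
proof -
  have "(F $ j * Y ^ j) $ n = 0" if "j \<in> {..N} - {..n}" for j
    using that startsby_zero_power_prefix[OF Y, of j] by (auto simp: fps_mult_nth intro!: sum.neutral)
  then have "(\<Sum>j\<le>n. (F $ j * Y ^ j) $ n) = (\<Sum>j\<le>N. (F $ j * Y ^ j) $ n)"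
    using assms(2) by (intro sum.mono_neutral_left) auto
  then show ?thesis by (simp add: subst_y_def fps_sum_nth)
qed

lemma subst_y_add: "subst_y Y (F + G) = subst_y Y F + subst_y Y G"
  and subst_y_diff: "subst_y Y (F - G) = subst_y Y F - subst_y Y G"
  by (intro fps_ext; simp add: subst_y_def algebra_simps sum.distrib sum_subtractf)+

lemma subst_y_sum: "finite S \<Longrightarrow> subst_y Y (\<Sum>s\<in>S. F s) = (\<Sum>s\<in>S. subst_y Y (F s))"
proof (induction S rule: finite_induct)
  case empty
  show ?case by (intro fps_ext) (simp add: subst_y_def)
qed (simp add: subst_y_add)

lemma subst_y_mult_const:
  assumes Y: "Y $ 0 = 0"
  shows "subst_y Y (F * fps_const A) = subst_y Y F * A"
proof (intro fps_ext)
  fix n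
  have "(subst_y Y F * A) $ n = (\<Sum>i=0..n. (\<Sum>j\<le>n. F $ j * Y ^ j) $ i * A $ (n - i))"
    unfolding fps_mult_nth by (intro sum.cong refl) (simp add: subst_y_nth[OF Y, of _ n])
  also have "\<dots> = ((\<Sum>j\<le>n. F $ j * Y ^ j) * A) $ n"
    by (simp add: fps_mult_nth)
  also have "\<dots> = subst_y Y (F * fps_const A) $ n"
    by (simp add: subst_y_def sum_distrib_left mult_ac)
  finally show "subst_y Y (F * fps_const A) $ n = (subst_y Y F * A) $ n" by simp
qed

lemma subst_y_mult_X:
  assumes Y: "Y $ 0 = 0"
  shows "subst_y Y (F * fps_X) = subst_y Y F * Y"
proof (intro fps_ext)
  fix n
  have "(subst_y Y F * Y) $ n = (\<Sum>i=0..n. (\<Sum>j\<le>n. F $ j * Y ^ j) $ i * Y $ (n - i))"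
    unfolding fps_mult_nth by (intro sum.cong refl) (simp add: subst_y_nth[OF Y, of _ n])
  also have "\<dots> = ((\<Sum>j\<le>n. F $ j * Y ^ j) * Y) $ n"
    by (simp add: fps_mult_nth)
  also have "(\<Sum>j\<le>n. F $ j * Y ^ j) * Y = (\<Sum>j\<le>n. F $ j * Y ^ Suc j)"
    by (simp add: sum_distrib_left mult_ac)
  also have "\<dots> = (\<Sum>j\<le>Suc n. (F * fps_X) $ j * Y ^ j)"
    unfolding sum.atMost_Suc_shift by simp
  also have "\<dots> $ n = subst_y Y (F * fps_X) $ n"
    by (simp only: subst_y_nth[OF Y, of n "Suc n"] le_SucI order_refl)
  finally show "subst_y Y (F * fps_X) $ n = (subst_y Y F * Y) $ n" by simp
qed

lemma subst_y_mult_X_power: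
  assumes Y: "Y $ 0 = 0"
  shows "subst_y Y (F * fps_X ^ k) = subst_y Y F * Y ^ k"
  by (induction k) (simp_all add: subst_y_mult_X[OF Y] power_Suc2 mult.assoc[symmetric] del: power_Suc)

lemma subst_y_series_in_x: "subst_y Y (series_in_x A) = A"
proof (intro fps_ext)
  fix n
  have "(\<Sum>j\<le>n. fps_const A $ j * Y ^ j) = (\<Sum>j\<in>{0}. fps_const A $ j * Y ^ j)"
    by (intro sum.mono_neutral_right) auto
  then show "subst_y Y (series_in_x A) $ n = A $ n" by (simp add: subst_y_def series_in_x_def)
qed

lemma subst_y_series_in_y: "subst_y Y (series_in_y B) = B oo Y"
  by (intro fps_ext) (simp add: subst_y_def series_in_y_def fps_compose_nth fps_sum_nth atLeast0AtMost)

text \<open>The series \<open>K(x, Y(x))\<close>, which is zero when \<open>y = Y(x)\<close>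
  parametrizes a branch of the kernel curve.\<close>

definition kernel_at :: "(int \<Rightarrow> int \<Rightarrow> real) \<Rightarrow> complex fps \<Rightarrow> complex fps" where
  "kernel_at p Y =
     (\<Sum>i\<in>steps. \<Sum>j\<in>steps. fps_const (of_real (p i j)) * fps_X ^ nat (1 - i) * Y ^ nat (1 - j)) - fps_X * Y"

lemma series_in_y_X_power: "series_in_y (fps_X ^ k) = fps_X ^ k"
  by (intro fps_ext) (simp add: series_in_y_def)

text \<open>The kernel is a sum of products of a series in x with a power of y, so compatibility of
  the substitution with these two kinds of factors is enough.\<close>

lemma subst_y_mult_kernel:
  assumes Y: "Y $ 0 = 0"
  shows "subst_y Y (F * kernel p) = subst_y Y F * kernel_at p Y"
proof -
  have mono: "subst_y Y (F * (series_in_x A * series_in_y (fps_X ^ k))) = subst_y Y F * (A * Y ^ k)" for A k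
    unfolding series_in_y_X_power series_in_x_def mult.assoc[symmetric]
    by (simp add: subst_y_mult_X_power[OF Y] subst_y_mult_const[OF Y])
  show ?thesis
    unfolding kernel_def kernel_at_def right_diff_distrib sum_distrib_left
    using mono[of fps_X 1]
    by (simp only: subst_y_diff subst_y_sum mono finite.intros power_one_right)
qed

section \<open>The product of the generating function and the kernel\<close>

lemma gen_fun_kernel_nth:
  "(gen_fun h * kernel p) $ J $ I = of_real ((\<Sum>u\<in>steps. \<Sum>v\<in>steps.
      p u v * (if nat (1 - u) \<le> I \<and> nat (1 - v) \<le> J then h (I - nat (1 - u)) (J - nat (1 - v)) else 0))
      - (if 1 \<le> I \<and> 1 \<le> J then h (I - 1) (J - 1) else 0))"
proof -
  have mono: "(gen_fun h * (series_in_x (fps_const (of_real c) * fps_X ^ k) * series_in_y (fps_X ^ l))) $ J $ I =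
       of_real (c * (if k \<le> I \<and> l \<le> J then h (I - k) (J - l) else 0))" for c k l
  proof -
    have eq: "gen_fun h * (series_in_x (fps_const (of_real c) * fps_X ^ k) * series_in_y (fps_X ^ l))
      = fps_const (fps_const (of_real c) * fps_X ^ k) * (gen_fun h * fps_X ^ l)"
      by (simp add: series_in_x_def series_in_y_X_power mult_ac)
    show ?thesis
      unfolding eq by (simp add: fps_X_power_mult_right_nth fps_X_power_mult_nth gen_fun_def mult.assoc)
  qed
  have mono_1: "(gen_fun h * (series_in_x fps_X * series_in_y fps_X)) $ J $ I =
      of_real (if 1 \<le> I \<and> 1 \<le> J then h (I - 1) (J - 1) else 0)"
    using mono[of 1 1 1] by (simp only: power_one_right of_real_1 fps_const_1_eq_1 mult_1)
  show ?thesis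
    unfolding kernel_def right_diff_distrib sum_distrib_left
    by (simp only: fps_sub_nth fps_sum_nth mono mono_1 of_real_diff of_real_sum)
qed

text \<open>The kernel contains the reversed steps multiplied by \<open>x y\<close>; this factor is
  the shift by one in both indices.\<close>

lemma gen_fun_kernel_Suc:
  "(gen_fun h * kernel p) $ Suc j $ Suc i = of_real (laplacian p h i j)"
  unfolding gen_fun_kernel_nth laplacian_eq by (cases i; cases j) simp_all

text \<open>Harmonicity leaves only coefficients on the two axes: those of \<open>y^0\<close> form
  \<open>A\<close> and those of \<open>x^0\<close> form \<open>B\<close>. Both contain the corner
  coefficient \<open>p 1 1 * h 0 0\<close>, which is 0.\<close>

lemma harmonic_decomposition:
  assumes h: "h \<in> harmonic_functions p" and p11: "p 1 1 = 0"
  obtains A B where "A $ 0 = 0" "B $ 0 = 0" "gen_fun h * kernel p = series_in_x A + series_in_y B"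
proof -
  let ?Q = "gen_fun h * kernel p"
  let ?B = "Abs_fps (\<lambda>j. ?Q $ j $ 0)"
  have 0: "?Q $ 0 $ 0 = 0" unfolding gen_fun_kernel_nth by (simp add: p11)
  have Suc: "?Q $ Suc j $ Suc i = 0" for i j
    using h by (simp only: gen_fun_kernel_Suc) (simp add: harmonic_functions_def)
  have "?Q = series_in_x (?Q $ 0) + series_in_y ?B"
  proof (intro fps_ext)
    fix j i
    show "?Q $ j $ i = (series_in_x (?Q $ 0) + series_in_y ?B) $ j $ i"
      using 0 Suc by (cases i; cases j) (simp_all add: series_in_x_def series_in_y_def del: fps_mult_nth_0)
  qed
  moreover have "?B $ 0 = 0" using 0 by simp
  ultimately show thesis using 0 that by blast
qed

lemma series_diff_eqD:
  assumes "series_in_x A - series_in_y B = series_in_x A' - series_in_y B'" and "B $ 0 = B' $ 0"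
  shows "A = A'" "B = B'"
proof -
  have *: "(series_in_x A - series_in_y B) $ j $ i = (series_in_x A' - series_in_y B') $ j $ i" for i j
    using assms(1) by simp
  show "B = B'"
  proof (intro fps_ext)
    fix j show "B $ j = B' $ j"
      using *[of j 0] assms(2) by (cases j) (simp_all add: series_in_x_def series_in_y_def)
  qed
  then show "A = A'" using assms(1) by (simp add: series_in_x_def)
qed

section \<open>Existence and uniqueness of \<open>P\<close>\<close>

lemma fps_compose_right_cancel:
  fixes V :: "complex fps"
  assumes V: "V $ 0 = 0" "V $ 1 \<noteq> 0" and "P oo V = Q oo V"
  shows "P = Q"
proof -
  have "P oo (V oo fps_inv V) = Q oo (V oo fps_inv V)"
    using assms by (simp add: fps_compose_assoc fps_inv_def)
  then show ?thesis using V by (simp add: fps_inv_right)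
qed

text \<open>Substituting \<open>y = Y(x)\<close> kills the kernel and ties \<open>A\<close> to
  \<open>B\<close>. The condition \<open>P $ 0 = 0\<close> normalizes \<open>P\<close>, since a
  constant cancels in the difference on the right-hand side.\<close>

lemma ex1_representation_y:
  assumes h: "h \<in> harmonic_functions p" and p11: "p 1 1 = 0"
    and Y: "Y $ 0 = 0" "kernel_at p Y = 0" and V: "V $ 0 = 0" "V $ 1 \<noteq> 0"
  shows "\<exists>!P. P $ 0 = 0 \<and> represented_by p (V oo Y) V h P"
proof (rule ex_ex1I)
  obtain A B where AB: "A $ 0 = 0" "B $ 0 = 0" "gen_fun h * kernel p = series_in_x A + series_in_y B"
    using harmonic_decomposition[of h p thesis, OF h p11] by blast
  have "A + (B oo Y) = subst_y Y (gen_fun h * kernel p)"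
    by (simp add: AB(3) subst_y_add subst_y_series_in_x subst_y_series_in_y)
  also have "\<dots> = 0" by (simp add: subst_y_mult_kernel Y)
  finally have A: "A = - (B oo Y)" by (simp add: eq_neg_iff_add_eq_0)
  \<comment> \<open>Matching the part in y forces \<open>P oo V = - B\<close>, which the
    compositional inverse of \<open>V\<close> solves; the part in x then follows from
    \<open>A = - (B oo Y)\<close>.\<close>
  define P where "P = - (B oo fps_inv V)"
  have PV: "P oo V = - B"
  proof -
    have "fps_inv V oo V = fps_X" using V by (simp add: fps_inv)
    moreover have "(B oo fps_inv V) oo V = B oo (fps_inv V oo V)"
      using V by (intro fps_compose_assoc[symmetric]) (simp_all add: fps_inv_def)
    ultimately show ?thesis by (simp add: P_def fps_compose_uminus)
  qed
  have "P oo (V oo Y) = P oo V oo Y" using V Y by (simp add: fps_compose_assoc)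
  then have PW: "P oo (V oo Y) = A" by (simp add: PV A fps_compose_uminus)
  have "series_in_y (- B) = - series_in_y B" by (intro fps_ext) (simp add: series_in_y_def)
  then have "P $ 0 = 0 \<and> represented_by p (V oo Y) V h P"
    unfolding represented_by_def PV PW AB(3) using AB(2) by (simp add: P_def)
  then show "\<exists>P. P $ 0 = 0 \<and> represented_by p (V oo Y) V h P" ..
next
  fix P Q
  assume P: "P $ 0 = 0 \<and> represented_by p (V oo Y) V h P"
    and Q: "Q $ 0 = 0 \<and> represented_by p (V oo Y) V h Q"
  then have "P oo V = Q oo V"
    using series_diff_eqD(2)[of "P oo (V oo Y)" "P oo V" "Q oo (V oo Y)" "Q oo V"]
    by (simp add: represented_by_def)
  then show "P = Q" using fps_compose_right_cancel V by blast
qed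

section \<open>Exchange of the two coordinates of the walk\<close>

abbreviation (input) transpose_fun :: "('a \<Rightarrow> 'a \<Rightarrow> 'b) \<Rightarrow> 'a \<Rightarrow> 'a \<Rightarrow> 'b" where
  "transpose_fun f \<equiv> (\<lambda>i j. f j i)"

lemma transpose_gen_fun: "transpose_fps (gen_fun h) = gen_fun (transpose_fun h)"
  by (intro fps_ext) (simp add: gen_fun_def)

lemma transpose_fps_sum:
  "transpose_fps (\<Sum>s\<in>S. F s) = (\<Sum>s\<in>S. transpose_fps (F s :: 'a::comm_ring_1 fps fps))"
  by (intro fps_ext) (simp add: fps_sum_nth)

lemma transpose_kernel: "transpose_fps (kernel p) = kernel (transpose_fun p)"
proof -
  have mono: "transpose_fps (series_in_x (fps_const c * A) * series_in_y B)
      = series_in_x (fps_const c * B) * series_in_y A" for c A B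
  proof -
    have "series_in_y (fps_const c * A) = fps_const (fps_const c) * series_in_y A"
      by (intro fps_ext) (simp add: series_in_y_def)
    moreover have "series_in_x (fps_const c * B) = fps_const (fps_const c) * series_in_x B"
      by (simp add: series_in_x_def)
    ultimately show ?thesis
      by (simp only: transpose_fps_mult transpose_series_in_x transpose_series_in_y mult_ac)
  qed
  have "transpose_fps (kernel p) = (\<Sum>i\<in>steps. \<Sum>j\<in>steps.
      series_in_x (fps_const (of_real (p i j)) * fps_X ^ nat (1 - j)) * series_in_y (fps_X ^ nat (1 - i)))
      - series_in_x fps_X * series_in_y fps_X"
    using mono[of 1 fps_X fps_X]
    by (simp only: kernel_def transpose_fps_diff transpose_fps_sum mono fps_const_1_eq_1 mult_1)
  also have "\<dots> = kernel (transpose_fun p)"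
    unfolding kernel_def by (subst sum.swap) simp
  finally show ?thesis .
qed

lemma laplacian_transpose: "laplacian (transpose_fun p) (transpose_fun h) i j = laplacian p h j i"
  unfolding laplacian_def by (subst sum.swap) (simp add: extend_by_0_def conj_commute)

lemma harmonic_transpose:
  "h \<in> harmonic_functions p \<Longrightarrow> transpose_fun h \<in> harmonic_functions (transpose_fun p)"
  by (simp add: harmonic_functions_def laplacian_transpose[of p h])

text \<open>The exchange reverses the difference on the right-hand side, hence the sign of
  \<open>P\<close>.\<close>

lemma represented_by_transpose:
  "represented_by (transpose_fun p) W V (transpose_fun h) P \<longleftrightarrow> represented_by p V W h (- P)"
proof -
  have neg: "series_in_x (- A) = - series_in_x A" "series_in_y (- A) = - series_in_y A" for A
    by (intro fps_ext; simp add: series_in_x_def series_in_y_def)+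
  have inj: "transpose_fps F = transpose_fps G \<longleftrightarrow> F = G" for F G :: "complex fps fps"
    by (metis fps_ext transpose_fps_nth)
  have "represented_by (transpose_fun p) W V (transpose_fun h) P \<longleftrightarrow>
     transpose_fps (gen_fun h * kernel p) = transpose_fps (series_in_y (P oo W) - series_in_x (P oo V))"
    by (simp add: represented_by_def transpose_fps_mult transpose_gen_fun transpose_kernel transpose_fps_diff
      transpose_series_in_x transpose_series_in_y)
  then show ?thesis unfolding inj by (simp add: represented_by_def fps_compose_uminus neg)
qed

lemma ex1_representation_x:
  assumes h: "h \<in> harmonic_functions p" and p11: "p 1 1 = 0"
    and X: "X $ 0 = 0" "kernel_at (transpose_fun p) X = 0" and W: "W $ 0 = 0" "W $ 1 \<noteq> 0"
  shows "\<exists>!P. P $ 0 = 0 \<and> represented_by p W (W oo X) h P"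
proof -
  obtain P where P: "P $ 0 = 0" "represented_by p W (W oo X) h (- P)"
    and uniq: "\<And>Q. Q $ 0 = 0 \<Longrightarrow> represented_by p W (W oo X) h (- Q) \<Longrightarrow> Q = P"
    using ex1_representation_y[OF harmonic_transpose[OF h] p11 X W]
    by (simp only: represented_by_transpose[of p "W oo X" W h]) blast
  show ?thesis
  proof (rule ex1I)
    show "(- P) $ 0 = 0 \<and> represented_by p W (W oo X) h (- P)" using P by simp
  next
    fix Q assume "Q $ 0 = 0 \<and> represented_by p W (W oo X) h Q"
    then have "- Q = P" by (intro uniq) simp_all
    then show "Q = - P" by (metis minus_minus)
  qed
qed

section \<open>Complex conjugation of coefficients\<close>

definition fps_cnj :: "complex fps \<Rightarrow> complex fps" where
  "fps_cnj F = Abs_fps (\<lambda>n. cnj (F $ n))"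

lemma fps_cnj_nth [simp]: "fps_cnj F $ n = cnj (F $ n)"
  by (simp add: fps_cnj_def)

lemma fps_cnj_mult: "fps_cnj (F * G) = fps_cnj F * fps_cnj G"
  by (intro fps_ext) (simp add: fps_mult_nth)

lemma fps_cnj_power: "fps_cnj (F ^ n) = fps_cnj F ^ n"
proof (induction n)
  case 0
  show ?case by (intro fps_ext) simp
qed (simp add: fps_cnj_mult)

lemma fps_cnj_compose: "fps_cnj (F oo G) = fps_cnj F oo fps_cnj G"
  by (intro fps_ext) (simp add: fps_compose_nth fps_cnj_power[symmetric])

lemma fps_cnj_eq_iff: "fps_cnj F = F \<longleftrightarrow> (\<forall>n. F $ n \<in> \<real>)"
  by (auto simp: fps_eq_iff Reals_cnj_iff)

lemma represented_by_cnj: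
  assumes "represented_by p W V h P" and WV: "fps_cnj W = W" "fps_cnj V = V"
  shows "represented_by p W V h (fps_cnj P)"
  unfolding represented_by_def
proof (intro fps_ext)
  fix j i
  have "(series_in_x (fps_cnj P oo W) - series_in_y (fps_cnj P oo V)) $ j $ i
    = (series_in_x (fps_cnj (P oo W)) - series_in_y (fps_cnj (P oo V))) $ j $ i"
    by (simp add: fps_cnj_compose WV)
  also have "\<dots> = cnj ((series_in_x (P oo W) - series_in_y (P oo V)) $ j $ i)"
    by (simp add: series_in_x_def series_in_y_def)
  also have "\<dots> = cnj ((gen_fun h * kernel p) $ j $ i)"
    using assms(1) by (simp add: represented_by_def)
  also have "\<dots> = (gen_fun h * kernel p) $ j $ i"
    unfolding gen_fun_kernel_nth by (rule complex_cnj_complex_of_real)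
  finally show "(gen_fun h * kernel p) $ j $ i
    = (series_in_x (fps_cnj P oo W) - series_in_y (fps_cnj P oo V)) $ j $ i" by simp
qed

text \<open>\<open>H\<close> and \<open>K\<close> have real coefficients. If \<open>W\<close> and
  \<open>V\<close> do too, conjugating the identity shows that \<open>fps_cnj P\<close> is a second
  solution, and uniqueness identifies it with \<open>P\<close>.\<close>

lemma real_representation:
  assumes "\<exists>!P. P $ 0 = 0 \<and> represented_by p W V h P"
    and "fps_cnj W = W" "fps_cnj V = V"
    and "P $ 0 = 0" "represented_by p W V h P"
  shows "P $ n \<in> \<real>"
proof -
  have "fps_cnj P $ 0 = 0 \<and> represented_by p W V h (fps_cnj P)"
    using assms represented_by_cnj by simp
  then have "fps_cnj P = P" using assms by blast
  then show ?thesis using fps_cnj_eq_iff by blast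
qed

section \<open>Winding numbers, injectivity and real expansions\<close>

text \<open>The factor \<open>\<sigma>\<close> moves the path off the cut of \<open>Ln\<close>. The
  difference \<open>d\<close> between a continuous logarithm along the path and the principal one is
  then continuous, and its values are logarithms of \<open>1 / \<sigma>\<close>. Distinct ones are
  at least \<open>2 * pi\<close> apart, so \<open>d\<close> is constant.\<close>

lemma winding_number_eq_Ln_diff:
  assumes \<gamma>: "path \<gamma>" and cut: "\<And>z. z \<in> path_image \<gamma> \<Longrightarrow> \<sigma> * (z - x) \<notin> \<real>\<^sub>\<le>\<^sub>0"
  shows "2 * of_real pi * \<i> * winding_number \<gamma> x = Ln (\<sigma> * (pathfinish \<gamma> - x)) - Ln (\<sigma> * (pathstart \<gamma> - x))"
proof -
  have "x \<notin> path_image \<gamma>" using cut[of x] by auto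
  then obtain q where q: "path q" "pathfinish q - pathstart q = 2 * of_real pi * \<i> * winding_number \<gamma> x"
      "\<And>t. t \<in> {0..1} \<Longrightarrow> \<gamma> t = x + exp (q t)"
    using winding_number_as_continuous_log[OF \<gamma>] by metis
  define d where "d t = q t - Ln (\<sigma> * (\<gamma> t - x))" for t
  have cut': "\<sigma> * (\<gamma> t - x) \<notin> \<real>\<^sub>\<le>\<^sub>0" if "t \<in> {0..1}" for t
    using that cut by (auto simp: path_image_def)
  have cont: "continuous_on {0..1} d"
    unfolding d_def using q(1) \<gamma> cut' by (intro continuous_intros) (auto simp: path_def)
  have exp_d: "exp (d t) = 1 / \<sigma>" if t: "t \<in> {0..1}" for t
  proof -
    have "\<sigma> * exp (q t) \<noteq> 0" using cut'[OF t] q(3)[OF t] by auto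
    then show ?thesis using q(3)[OF t] by (simp add: d_def exp_diff)
  qed
  have "d constant_on {0..1}"
  proof (rule continuous_discrete_range_constant[OF _ cont])
    fix t :: real assume t: "t \<in> {0..1}"
    have "2 * pi \<le> norm (d s - d t)" if s: "s \<in> {0..1}" "d s \<noteq> d t" for s
    proof -
      obtain n :: int where n: "d s = d t + (of_int (2 * n) * pi) * \<i>"
        using exp_d[OF t] exp_d[OF s(1)] exp_eq by metis
      then have "norm (d s - d t) = 2 * pi * \<bar>of_int n\<bar>" by (simp add: norm_mult)
      moreover have "n \<noteq> 0" using n s(2) by auto
      then have "(1::real) \<le> \<bar>of_int n\<bar>" by linarith
      ultimately show ?thesis by simp
    qed
    then show "\<exists>e>0. \<forall>s. s \<in> {0..1} \<and> d s \<noteq> d t \<longrightarrow> e \<le> norm (d s - d t)"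
      by (intro exI[of _ "2 * pi"]) auto
  qed simp
  then obtain k where "\<And>t. t \<in> {0..1} \<Longrightarrow> d t = k" unfolding constant_on_def by blast
  then have "d 0 = d 1" by simp
  then show ?thesis using q(2) by (simp add: d_def pathstart_def pathfinish_def algebra_simps)
qed

lemma Im_Ln_ii_mult:
  assumes "r > 0"
  shows "Im (Ln (\<i> * of_real r)) = pi / 2" "Im (Ln (- (\<i> * of_real r))) = - pi / 2"
proof -
  have "Ln (of_real r * \<i>) = of_real (ln r) + Ln \<i>" "Ln (of_real r * (- \<i>)) = of_real (ln r) + Ln (- \<i>)"
    using assms Ln_times_of_real[of r \<i>] Ln_times_of_real[of r "- \<i>"] by (simp_all add: Ln_of_real)
  then show "Im (Ln (\<i> * of_real r)) = pi / 2" "Im (Ln (- (\<i> * of_real r))) = - pi / 2"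
    by (simp_all add: mult.commute)
qed

text \<open>The winding number of the closed curve is found by following a branch of the logarithm along each half.\<close>

lemma of_real_in_inside_arcs:
  fixes u l :: "real \<Rightarrow> complex" and a b s t x :: real
  assumes "a \<le> b" and u: "continuous_on {a..b} u" and l: "continuous_on {a..b} l"
    and ends: "u a = of_real s" "l a = of_real s" "u b = of_real t" "l b = of_real t" and x: "s < x" "x < t"
    and Im_u: "\<And>y. y \<in> {a..b} \<Longrightarrow> Im (u y) \<ge> 0" and Im_l: "\<And>y. y \<in> {a..b} \<Longrightarrow> Im (l y) \<le> 0"
    and off: "of_real x \<notin> u ` {a..b} \<union> l ` {a..b}"
  shows "of_real x \<in> inside (u ` {a..b} \<union> l ` {a..b})"
proof -
  define \<gamma> where "\<gamma> = u \<circ> linepath a b"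
  define \<delta> where "\<delta> = l \<circ> linepath a b"
  have seg: "path_image (linepath a b) = {a..b}"
    using assms(1) by (simp add: closed_segment_eq_real_ivl)
  have path: "path \<gamma>" "path \<delta>"
    unfolding \<gamma>_def \<delta>_def using u l seg by (auto intro!: path_continuous_image)
  have img: "path_image \<gamma> = u ` {a..b}" "path_image \<delta> = l ` {a..b}"
    unfolding \<gamma>_def \<delta>_def path_image_compose seg by simp_all
  have st: "pathstart \<gamma> = of_real s" "pathfinish \<gamma> = of_real t" "pathstart \<delta> = of_real s" "pathfinish \<delta> = of_real t"
    using ends by (simp_all add: \<gamma>_def \<delta>_def pathstart_compose pathfinish_compose)
  \<comment> \<open>Multiplication by \<open>- \<i>\<close> turns the closed upper half-plane at
    \<open>x\<close> into the right half-plane, so the upper arc avoids the cut. The arguments at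
    its ends are \<open>pi / 2\<close> and \<open>- pi / 2\<close>. The lower arc is treated with
    \<open>\<i>\<close>, and the closed curve has winding number -1.\<close>
  have "2 * of_real pi * \<i> * winding_number \<gamma> (of_real x)
      = Ln ((- \<i>) * (of_real t - of_real x)) - Ln ((- \<i>) * (of_real s - of_real x))"
    unfolding st[symmetric]
  proof (rule winding_number_eq_Ln_diff[OF path(1)])
    fix z assume "z \<in> path_image \<gamma>"
    then have z: "z \<in> u ` {a..b}" by (simp add: img)
    then have "z \<noteq> of_real x" using off by blast
    moreover have "Im z \<ge> 0" using z Im_u by auto
    ultimately
    show "- \<i> * (z - of_real x) \<notin> \<real>\<^sub>\<le>\<^sub>0"
      by (auto simp: complex_nonpos_Reals_iff complex_eq_iff)
  qed
  moreover have "(- \<i>) * (of_real t - of_real x) = - (\<i> * of_real (t - x))"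
      "(- \<i>) * (of_real s - of_real x) = \<i> * of_real (x - s)"
    by (simp_all add: algebra_simps)
  ultimately have "Im (2 * of_real pi * \<i> * winding_number \<gamma> (of_real x))
     = Im (Ln (- (\<i> * of_real (t - x)))) - Im (Ln (\<i> * of_real (x - s)))"
    by (simp only: minus_complex.sel)
  then have w1: "2 * pi * Re (winding_number \<gamma> (of_real x)) = - pi"
    using x by (simp only: Im_Ln_ii_mult diff_gt_0_iff_gt) simp
  have "2 * of_real pi * \<i> * winding_number \<delta> (of_real x)
      = Ln (\<i> * (of_real t - of_real x)) - Ln (\<i> * (of_real s - of_real x))"
    unfolding st(3,4)[symmetric]
  proof (rule winding_number_eq_Ln_diff[OF path(2)])
    fix z assume "z \<in> path_image \<delta>"
    then have z: "z \<in> l ` {a..b}" by (simp add: img)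
    then have "z \<noteq> of_real x" using off by blast
    moreover have "Im z \<le> 0" using z Im_l by auto
    ultimately
    show "\<i> * (z - of_real x) \<notin> \<real>\<^sub>\<le>\<^sub>0"
      by (auto simp: complex_nonpos_Reals_iff complex_eq_iff)
  qed
  moreover have "\<i> * (of_real t - of_real x) = \<i> * of_real (t - x)"
      "\<i> * (of_real s - of_real x) = - (\<i> * of_real (x - s))"
    by (simp_all add: algebra_simps)
  ultimately have "Im (2 * of_real pi * \<i> * winding_number \<delta> (of_real x))
     = Im (Ln (\<i> * of_real (t - x))) - Im (Ln (- (\<i> * of_real (x - s))))"
    by (simp only: minus_complex.sel)
  then have w2: "2 * pi * Re (winding_number \<delta> (of_real x)) = pi"
    using x by (simp only: Im_Ln_ii_mult diff_gt_0_iff_gt) simp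
  have off': "of_real x \<notin> path_image \<gamma>" "of_real x \<notin> path_image \<delta>"
    using off img by auto
  let ?c = "\<gamma> +++ reversepath \<delta>"
  have "winding_number ?c (of_real x) = winding_number \<gamma> (of_real x) - winding_number \<delta> (of_real x)"
    using path off' st by (simp add: winding_number_join winding_number_reversepath)
  then have "2 * pi * Re (winding_number ?c (of_real x))
      = 2 * pi * Re (winding_number \<gamma> (of_real x)) - 2 * pi * Re (winding_number \<delta> (of_real x))"
    by (simp add: right_diff_distrib)
  then have "2 * pi * Re (winding_number ?c (of_real x)) = - 2 * pi"
    using w1 w2 by linarith
  then have "winding_number ?c (of_real x) \<noteq> 0" by auto
  moreover have "path ?c" "pathfinish ?c = pathstart ?c"
    using path st by simp_all
  moreover have "path_image ?c = u ` {a..b} \<union> l ` {a..b}"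
    using img st by (simp add: path_image_join)
  ultimately have "of_real x \<notin> outside (u ` {a..b} \<union> l ` {a..b})"
    using winding_number_zero_in_outside by metis
  then show ?thesis using off inside_Un_outside by blast
qed

lemma connected_unbounded_subset_outside:
  assumes "connected C" "C \<inter> S = {}" "\<not> bounded C"
  shows "C \<subseteq> outside S"
proof
  fix z assume z: "z \<in> C"
  then have "C \<subseteq> connected_component_set (- S) z"
    using assms by (intro connected_component_maximal) auto
  then have "\<not> bounded (connected_component_set (- S) z)"
    using assms(3) bounded_subset by blast
  then show "z \<in> outside S" using z assms(2) by (auto simp: outside_def)
qed

text \<open>If two points have the same image, the images of disjoint neighbourhoods overlap in a
  nonempty open set. The image of \<open>N\<close> is negligible and cannot cover it, so some value
  is taken twice outside \<open>N\<close>. This carries injectivity of \<omega> across the slit that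
  comes from the boundary curve.\<close>

lemma inj_on_if_inj_off_negligible:
  fixes g :: "complex \<Rightarrow> complex"
  assumes hol: "g holomorphic_on D" and D: "open D" "connected D" and N: "negligible N"
    and inj: "inj_on g (D - N)"
  shows "inj_on g D"
proof (rule inj_onI, rule ccontr)
  fix y z assume yz: "y \<in> D" "z \<in> D" "g y = g z" "y \<noteq> z"
  have "\<not> g constant_on D"
  proof
    assume "g constant_on D"
    then obtain a where "D - N \<subseteq> {a}"
      using inj unfolding constant_on_def inj_on_def by (metis Diff_iff insertI1 subsetI)
    then have "D \<subseteq> insert a N" by auto
    moreover have "negligible (insert a N)" using N by simp
    ultimately show False using open_not_negligible[OF D(1)] yz(1) negligible_subset by blast
  qed
  note open_image = open_mapping_thm[OF hol D _ _ this]
  obtain U V where UV: "open U" "open V" "y \<in> U" "z \<in> V" "U \<inter> V = {}"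
    using hausdorff[OF yz(4)] by blast
  define W where "W = g ` (U \<inter> D) \<inter> g ` (V \<inter> D)"
  have "open W" unfolding W_def using UV D(1) by (intro open_Int open_image) auto
  moreover have "W \<noteq> {}" using UV yz unfolding W_def by auto
  ultimately have "\<not> negligible W" using open_not_negligible by blast
  moreover have "negligible (g ` (D \<inter> N))"
  proof (rule negligible_differentiable_image_negligible)
    show "negligible (D \<inter> N)" using N by (meson Int_lower2 negligible_subset)
    show "g differentiable_on D \<inter> N"
      using hol holomorphic_on_imp_differentiable_on differentiable_on_subset by blast
  qed simp
  ultimately obtain w where w: "w \<in> W" "w \<notin> g ` (D \<inter> N)"
    using negligible_subset by blast
  then obtain a b where ab: "a \<in> U" "a \<in> D" "b \<in> V" "b \<in> D" "g a = w" "g b = w"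
    unfolding W_def by auto
  then have "a \<in> D - N" "b \<in> D - N" using w(2) by (metis DiffI IntI imageI)+
  then have "a = b" using inj ab by (auto dest: inj_onD)
  with ab UV show False by auto
qed

section \<open>Reflection in the real axis\<close>

lemma has_fps_expansion_cnj:
  assumes "f has_fps_expansion F"
  shows "(\<lambda>z. cnj (f (cnj z))) has_fps_expansion fps_cnj F"
proof -
  have r: "fps_conv_radius F > 0" and ev: "eventually (\<lambda>z. eval_fps F z = f z) (nhds 0)"
    using assms by (auto simp: has_fps_expansion_def)
  have "eventually (\<lambda>z::complex. z \<in> eball 0 (fps_conv_radius F)) (nhds 0)"
    using r by (intro eventually_nhds_in_open) (auto simp: zero_ereal_def)
  with ev have "eventually (\<lambda>z. (\<lambda>n. F $ n * z ^ n) sums f z) (nhds 0)"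
    by eventually_elim (use sums_eval_fps in \<open>force simp: dist_norm\<close>)
  moreover have "filterlim cnj (nhds 0) (nhds 0)"
    using tendsto_cnj[OF tendsto_ident_at[of "0::complex" UNIV]] tendsto_at_iff_tendsto_nhds[of cnj 0] by simp
  ultimately have "eventually (\<lambda>z. (\<lambda>n. F $ n * cnj z ^ n) sums f (cnj z)) (nhds 0)"
    by (rule eventually_compose_filterlim)
  then show ?thesis
  proof (intro has_fps_expansionI, eventually_elim)
    case (elim z)
    then have "(\<lambda>n. cnj (F $ n * cnj z ^ n)) sums cnj (f (cnj z))" by (simp only: sums_cnj)
    then show ?case by simp
  qed
qed

text \<open>The function agrees with its reflection on a real segment ending at 0, so the zeros of
  the difference accumulate there and its expansion vanishes. A one-sided segment is used because,
  for an origin on the boundary curve, only negative arguments correspond to real points of the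
  domain.\<close>

lemma fps_cnj_eq_if_real_values:
  assumes f: "f has_fps_expansion F" and "\<delta> > 0"
    and real: "\<And>s. - \<delta> < s \<Longrightarrow> s < 0 \<Longrightarrow> f (of_real s) \<in> \<real>"
  shows "fps_cnj F = F"
proof (rule ccontr)
  assume "fps_cnj F \<noteq> F"
  then have ne: "F - fps_cnj F \<noteq> 0" by simp
  let ?g = "\<lambda>z. f z - cnj (f (cnj z))"
  have "?g has_fps_expansion F - fps_cnj F"
    using f has_fps_expansion_cnj by (intro fps_expansion_intros) auto
  then have "eventually (\<lambda>z. ?g z \<noteq> 0) (at 0)"
    using ne has_laurent_expansion_nonzero_imp_eventually_nonzero[of ?g "fps_to_fls (F - fps_cnj F)"]
    by (simp add: has_fps_expansion_to_laurent)
  then obtain e where e: "e > 0" "\<And>z. z \<noteq> 0 \<Longrightarrow> dist z 0 < e \<Longrightarrow> ?g z \<noteq> 0"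
    unfolding eventually_at by auto
  define s where "s = - min \<delta> e / 2"
  have "s < 0" "- \<delta> < s" "- e < s" using e(1) assms(2) by (auto simp: s_def)
  then have "?g (of_real s) = 0" using real[of s] by (simp add: Reals_cnj_iff)
  moreover have "of_real s \<noteq> (0::complex)" "dist (of_real s :: complex) 0 < e"
    using \<open>s < 0\<close> \<open>- e < s\<close> by auto
  ultimately show False using e(2) by blast
qed

section \<open>The boundary curve and the case of an interior origin\<close>

lemma isCont_eventually_in_open:
  assumes "isCont f x" "open U" "f x \<in> U"
  shows "\<forall>\<^sub>F z in nhds x. f z \<in> U"
proof -
  have "(f \<longlongrightarrow> f x) (nhds x)"
    using assms(1) by (simp add: isCont_def tendsto_at_iff_tendsto_nhds)
  then show ?thesis using assms(2,3) by (rule topological_tendstoD)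
qed

section \<open>The branch of the kernel curve through the origin\<close>

text \<open>\<open>X_plus\<close> with the square root moved to the denominator. For
  \<open>p 1 1 = 0\<close> and \<open>p 0 1 > 0\<close> this is analytic at 0 even if
  \<open>a_tilde p 0 = 0\<close>: the denominator there is \<open>- 2 * p 0 1\<close>, and the
  numerator vanishes.\<close>

definition small_root :: "(int \<Rightarrow> int \<Rightarrow> real) \<Rightarrow> complex \<Rightarrow> complex" where
  "small_root p y = 2 * c_tilde p y / (- b_tilde p y - csqrt (discr p y))"

lemma analytic_on_a_tilde [analytic_intros]: "f analytic_on S \<Longrightarrow> (\<lambda>z. a_tilde p (f z)) analytic_on S"
  and analytic_on_b_tilde [analytic_intros]: "f analytic_on S \<Longrightarrow> (\<lambda>z. b_tilde p (f z)) analytic_on S"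
  and analytic_on_c_tilde [analytic_intros]: "f analytic_on S \<Longrightarrow> (\<lambda>z. c_tilde p (f z)) analytic_on S"
  unfolding a_tilde_eq b_tilde_eq c_tilde_eq by (intro analytic_intros; assumption)+

lemma analytic_on_discr [analytic_intros]: "f analytic_on S \<Longrightarrow> (\<lambda>z. discr p (f z)) analytic_on S"
  unfolding discr_def by (intro analytic_intros)

context
  fixes p :: "int \<Rightarrow> int \<Rightarrow> real"
  assumes p11: "p 1 1 = 0" and p01: "p 0 1 > 0"
begin

lemma csqrt_discr_0: "csqrt (discr p 0) = of_real (p 0 1)" "discr p 0 \<notin> \<real>\<^sub>\<le>\<^sub>0"
proof -
  have d: "discr p 0 = of_real ((p 0 1)\<^sup>2)"
    by (simp add: discr_def a_tilde_eq b_tilde_eq c_tilde_eq p11)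
  then show "csqrt (discr p 0) = of_real (p 0 1)"
    unfolding d using p01 by (subst csqrt_of_real) simp_all
  show "discr p 0 \<notin> \<real>\<^sub>\<le>\<^sub>0"
    unfolding d using p01 by (simp del: of_real_power)
qed

lemma small_root_denominator:
  "(\<lambda>y. - b_tilde p y - csqrt (discr p y)) analytic_on {0}" "- b_tilde p 0 - csqrt (discr p 0) \<noteq> 0"
proof -
  show "(\<lambda>y. - b_tilde p y - csqrt (discr p y)) analytic_on {0}"
    using csqrt_discr_0(2) by (intro analytic_intros) auto
  have "- b_tilde p 0 - csqrt (discr p 0) = of_real (- 2 * p 0 1)"
    unfolding csqrt_discr_0 by (simp add: b_tilde_eq)
  then show "- b_tilde p 0 - csqrt (discr p 0) \<noteq> 0" using p01 by (simp only: of_real_eq_0_iff)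
qed

lemma small_root_analytic: "small_root p analytic_on {0}"
  unfolding small_root_def using small_root_denominator(2) csqrt_discr_0(2) by (intro analytic_intros) auto

lemma small_root_0: "small_root p 0 = 0"
  by (simp add: small_root_def c_tilde_eq p11)

lemma eventually_small_root_denominator: "\<forall>\<^sub>F y in nhds 0. - b_tilde p y - csqrt (discr p y) \<noteq> 0"
  using isCont_eventually_in_open[OF analytic_at_imp_isCont[OF small_root_denominator(1)], of "- {0}"]
    small_root_denominator(2) by (simp add: open_Compl)

lemma small_root_kernel:
  "\<forall>\<^sub>F y in nhds 0. a_tilde p y * (small_root p y)\<^sup>2 + b_tilde p y * small_root p y + c_tilde p y = 0"
  using eventually_small_root_denominator
proof eventually_elim
  case (elim y)
  define s where "s = csqrt (discr p y)"
  define d where "d = - b_tilde p y - s"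
  have s2: "s\<^sup>2 = (b_tilde p y)\<^sup>2 - 4 * a_tilde p y * c_tilde p y"
    by (simp add: s_def discr_def)
  have d0: "d \<noteq> 0" using elim by (simp add: d_def s_def)
  have "(a_tilde p y * (small_root p y)\<^sup>2 + b_tilde p y * small_root p y + c_tilde p y) * d\<^sup>2
     = c_tilde p y * (4 * a_tilde p y * c_tilde p y + 2 * b_tilde p y * d + d\<^sup>2)"
    using d0 by (simp add: small_root_def s_def[symmetric] d_def[symmetric] power2_eq_square field_simps)
  also have "4 * a_tilde p y * c_tilde p y + 2 * b_tilde p y * d + d\<^sup>2 = 0"
    using s2 unfolding d_def by (simp add: power2_eq_square algebra_simps)
  finally show ?case using d0 by simp
qed

lemma X_plus_eq_small_root:
  "\<forall>\<^sub>F y in nhds 0. a_tilde p y \<noteq> 0 \<longrightarrow> X_plus p y = small_root p y"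
  using eventually_small_root_denominator
proof eventually_elim
  case (elim y)
  define s where "s = csqrt (discr p y)"
  have s2: "s\<^sup>2 = (b_tilde p y)\<^sup>2 - 4 * a_tilde p y * c_tilde p y"
    by (simp add: s_def discr_def)
  have "(- b_tilde p y + s) * (- b_tilde p y - s) = 4 * a_tilde p y * c_tilde p y"
    using s2 by (simp add: power2_eq_square algebra_simps)
  then show ?case
    using elim unfolding X_plus_def small_root_def s_def[symmetric]
    by (auto simp: divide_simps)
qed

text \<open>Subtracting the kernel equations of \<open>x\<close> and of the small root
  \<open>R\<close> gives \<open>(x - R) * (a * (x + R) + b) = 0\<close>, whose second factor is
  close to \<open>p 0 1\<close> near the origin.\<close>

lemma small_root_unique:
  "\<exists>r>0. \<forall>x y. norm x < r \<longrightarrow> norm y < r \<longrightarrow>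
     a_tilde p y * x\<^sup>2 + b_tilde p y * x + c_tilde p y = 0 \<longrightarrow> x = small_root p y"
proof -
  let ?R = "small_root p"
  let ?q = "\<lambda>z. a_tilde p (snd z) * (fst z + ?R (snd z)) + b_tilde p (snd z)"
  have "isCont (\<lambda>z::complex \<times> complex. ?R (snd z)) (0, 0)"
    using analytic_at_imp_isCont[OF small_root_analytic] 
    by (intro isCont_o2[where g = ?R and f = snd and a = "(0, 0)"] continuous_intros) simp
  then have "isCont ?q (0, 0)"
    unfolding a_tilde_eq b_tilde_eq by (intro continuous_intros) auto
  moreover have "?q (0, 0) \<noteq> 0" using p01 by (simp add: small_root_0 b_tilde_eq)
  ultimately have "\<forall>\<^sub>F z in nhds (0, 0). ?q z \<noteq> 0"
    using isCont_eventually_in_open[where f = ?q and U = "- {0}"] by (simp add: open_Compl)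
  then obtain e where e: "e > 0" "\<And>z. dist z (0, 0) < e \<Longrightarrow> ?q z \<noteq> 0"
    unfolding eventually_nhds_metric by blast
  obtain e' where e': "e' > 0" "\<And>y. dist y 0 < e' \<Longrightarrow>
      a_tilde p y * (?R y)\<^sup>2 + b_tilde p y * ?R y + c_tilde p y = 0"
    using small_root_kernel unfolding eventually_nhds_metric by blast
  show ?thesis
  proof (intro exI[of _ "min (e / 2) e'"] conjI allI impI)
    fix x y :: complex
    assume x: "norm x < min (e / 2) e'" and y: "norm y < min (e / 2) e'"
      and K: "a_tilde p y * x\<^sup>2 + b_tilde p y * x + c_tilde p y = 0"
    have "dist (x, y) (0, 0) < e"
      using norm_Pair_le[of x y] x y by (simp add: dist_norm)
    from e(2)[OF this] have "a_tilde p y * (x + ?R y) + b_tilde p y \<noteq> 0" by simp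
    moreover have "a_tilde p y * (?R y)\<^sup>2 + b_tilde p y * ?R y + c_tilde p y = 0"
      using e'(2)[of y] y by simp
    with K have "(x - ?R y) * (a_tilde p y * (x + ?R y) + b_tilde p y) = 0"
      by algebra
    ultimately show "x = ?R y" by simp
  qed (use e(1) e'(1) in auto)
qed

end

text \<open>Passage from the analytic to the formal root. The model is transposed because
  \<open>kernel_at\<close> substitutes for the second variable, whereas \<open>X\<close> is a series
  in y substituted for x.\<close>

lemma kernel_at_root:
  assumes R: "R has_fps_expansion X"
    and K: "\<forall>\<^sub>F y in nhds 0. a_tilde p y * (R y)\<^sup>2 + b_tilde p y * R y + c_tilde p y = 0"
  shows "kernel_at (transpose_fun p) X = 0"
proof -
  let ?f = "\<lambda>y. (\<Sum>i\<in>steps. \<Sum>j\<in>steps. of_real (p j i) * y ^ nat (1 - i) * R y ^ nat (1 - j)) - y * R y"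
  have "?f has_fps_expansion kernel_at (transpose_fun p) X"
    unfolding kernel_at_def by (intro fps_expansion_intros R)
  moreover have "?f y = a_tilde p y * (R y)\<^sup>2 + b_tilde p y * R y + c_tilde p y" for y
    by (simp add: a_tilde_eq b_tilde_eq c_tilde_eq power2_eq_square algebra_simps)
  then have "\<forall>\<^sub>F y in nhds 0. ?f y = 0" using K by simp
  then have "?f has_fps_expansion 0"
    using has_fps_expansion_cong[of ?f "\<lambda>_. 0" 0 0] by simp
  ultimately show ?thesis using fps_expansion_unique_complex by blast
qed

section \<open>The boundary curve and the real points that it encloses\<close>

context branch_walk
begin

lemma discr_real_nonpos: "y \<in> {y1..1} \<Longrightarrow> discr_real p y \<le> 0"
  using discr_real_neg[of y] discr_real_ends by (cases "y = y1"; cases "y = 1") auto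

lemma X_plus_of_real:
  assumes "y \<in> {y1..1}"
  shows "X_plus p (of_real y) = of_real (- b_real p y / (2 * a_real p y)) + \<i> * of_real (sqrt (- discr_real p y) / (2 * a_real p y))"
    and "X_minus p (of_real y) = of_real (- b_real p y / (2 * a_real p y)) - \<i> * of_real (sqrt (- discr_real p y) / (2 * a_real p y))"
proof -
  have "csqrt (discr p (of_real y)) = \<i> * of_real (sqrt (- discr_real p y))"
    using discr_real_nonpos[OF assms] by (simp add: discr_of_real)
  then show "X_plus p (of_real y) = of_real (- b_real p y / (2 * a_real p y)) + \<i> * of_real (sqrt (- discr_real p y) / (2 * a_real p y))"
    "X_minus p (of_real y) = of_real (- b_real p y / (2 * a_real p y)) - \<i> * of_real (sqrt (- discr_real p y) / (2 * a_real p y))"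
    unfolding X_plus_def X_minus_def
    by (simp_all add: a_tilde_of_real b_tilde_of_real add_divide_distrib diff_divide_distrib)
qed

lemma continuous_on_coeffs:
  "continuous_on S (a_real p)" "continuous_on S (b_real p)" "continuous_on S (discr_real p)"
  unfolding discr_real_def a_real_def b_real_def c_real_def by (intro continuous_intros)+

lemma continuous_on_X:
  "continuous_on {y1..1} (\<lambda>y. X_plus p (of_real y))" "continuous_on {y1..1} (\<lambda>y. X_minus p (of_real y))"
proof -
  note [continuous_intros] = continuous_on_coeffs
  have a: "\<forall>y\<in>{y1..1}. 2 * a_real p y \<noteq> 0" using a_real_pos_on by (simp add: less_imp_neq[symmetric])
  have "continuous_on {y1..1} (\<lambda>y. complex_of_real (- b_real p y / (2 * a_real p y)) + \<i> * of_real (sqrt (- discr_real p y) / (2 * a_real p y)))"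
    "continuous_on {y1..1} (\<lambda>y. complex_of_real (- b_real p y / (2 * a_real p y)) - \<i> * of_real (sqrt (- discr_real p y) / (2 * a_real p y)))"
    by (intro continuous_intros a)+
  then show "continuous_on {y1..1} (\<lambda>y. X_plus p (of_real y))" "continuous_on {y1..1} (\<lambda>y. X_minus p (of_real y))"
    by (simp_all only: X_plus_of_real cong: continuous_on_cong)
qed

text \<open>The double root at \<open>y1\<close>, where the two conjugate arcs meet; their other
  common end is 1.\<close>

definition x1 :: real where "x1 = - b_real p y1 / (2 * a_real p y1)"

lemma X_ends:
  "X_plus p (of_real y1) = of_real x1" "X_minus p (of_real y1) = of_real x1"
  "X_plus p (of_real 1) = of_real 1" "X_minus p (of_real 1) = of_real 1"
proof -
  have "b_real p 1 = - 2 * a_real p 1"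
    using total drift_x by (simp add: b_real_def a_real_def)
  moreover have "a_real p 1 > 0" using a_real_pos_on[of 1] y1 by simp
  ultimately show "X_plus p (of_real 1) = of_real 1" "X_minus p (of_real 1) = of_real 1"
    using X_plus_of_real[of 1] y1 discr_real_ends by simp_all
  show "X_plus p (of_real y1) = of_real x1" "X_minus p (of_real y1) = of_real x1"
    using X_plus_of_real[of y1] y1 discr_real_ends by (simp_all add: x1_def)
qed

lemma Im_X:
  assumes "y \<in> {y1..1}"
  shows "Im (X_plus p (of_real y)) \<ge> 0" "Im (X_minus p (of_real y)) \<le> 0"
    "Im (X_plus p (of_real y)) = 0 \<Longrightarrow> y = y1 \<or> y = 1" "Im (X_minus p (of_real y)) = 0 \<Longrightarrow> y = y1 \<or> y = 1"
proof -
  have a: "a_real p y > 0" using a_real_pos_on assms by simp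
  show "Im (X_plus p (of_real y)) \<ge> 0" "Im (X_minus p (of_real y)) \<le> 0"
    unfolding X_plus_of_real[OF assms] using a discr_real_nonpos[OF assms] by simp_all
  have "discr_real p y = 0 \<Longrightarrow> y = y1 \<or> y = 1"
    using discr_real_neg[of y] assms by force
  then show "Im (X_plus p (of_real y)) = 0 \<Longrightarrow> y = y1 \<or> y = 1" "Im (X_minus p (of_real y)) = 0 \<Longrightarrow> y = y1 \<or> y = 1"
    unfolding X_plus_of_real[OF assms] using a by simp_all
qed

lemma of_real_in_boundary_curve:
  assumes "of_real x \<in> boundary_curve p y1"
  shows "x = x1 \<or> x = 1"
proof -
  obtain y where y: "y \<in> {y1..1}" "of_real x = X_plus p (of_real y) \<or> of_real x = X_minus p (of_real y)"
    using assms by (auto simp: boundary_curve_def)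
  then have "y = y1 \<or> y = 1" using Im_X(3,4)[OF y(1)] Im_complex_of_real by metis
  then show ?thesis using y(2) X_ends by (metis of_real_eq_iff)
qed

text \<open>The last conclusion is the product formula for two conjugate roots. It serves to bound
  \<open>y\<close> by a multiple of \<open>(cmod z)^2\<close> near the origin.\<close>

lemma boundary_curve_root:
  assumes "z \<in> boundary_curve p y1"
  obtains y where "y \<in> {y1..1}" "a_tilde p (of_real y) * z\<^sup>2 + b_tilde p (of_real y) * z + c_tilde p (of_real y) = 0"
    "(cmod z)\<^sup>2 * a_real p y = c_real p y"
proof -
  obtain y where y: "y \<in> {y1..1}" "z = X_plus p (of_real y) \<or> z = X_minus p (of_real y)"
    using assms by (auto simp: boundary_curve_def)
  have a: "a_real p y > 0" using a_real_pos_on y by simp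
  then have a': "a_tilde p (of_real y) \<noteq> 0" by (simp add: a_tilde_of_real)
  define s where "s = csqrt (discr p (of_real y))"
  have s2: "s\<^sup>2 = (b_tilde p (of_real y))\<^sup>2 - 4 * a_tilde p (of_real y) * c_tilde p (of_real y)"
    by (simp add: s_def discr_def)
  have "2 * a_tilde p (of_real y) * z + b_tilde p (of_real y) = s \<or> 2 * a_tilde p (of_real y) * z + b_tilde p (of_real y) = - s"
    using y(2) a' by (auto simp: X_plus_def X_minus_def s_def[symmetric])
  then have "(2 * a_tilde p (of_real y) * z + b_tilde p (of_real y))\<^sup>2 = s\<^sup>2" by auto
  then have "4 * a_tilde p (of_real y) * (a_tilde p (of_real y) * z\<^sup>2 + b_tilde p (of_real y) * z + c_tilde p (of_real y)) = 0"
    unfolding s2 by (simp add: power2_eq_square algebra_simps)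
  then have 1: "a_tilde p (of_real y) * z\<^sup>2 + b_tilde p (of_real y) * z + c_tilde p (of_real y) = 0"
    using a' by simp
  have "(cmod z)\<^sup>2 = (b_real p y / (2 * a_real p y))\<^sup>2 + (sqrt (- discr_real p y) / (2 * a_real p y))\<^sup>2"
    using y(2) unfolding X_plus_of_real[OF y(1)] cmod_power2 by auto
  also have "\<dots> = ((b_real p y)\<^sup>2 - discr_real p y) / (2 * a_real p y)\<^sup>2"
    using discr_real_nonpos[OF y(1)] by (simp add: power_divide diff_divide_distrib)
  also have "(b_real p y)\<^sup>2 - discr_real p y = 4 * a_real p y * c_real p y"
    by (simp add: discr_real_def)
  also have "4 * a_real p y * c_real p y / (2 * a_real p y)\<^sup>2 = c_real p y / a_real p y"
    using a by (simp add: power2_eq_square)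
  finally have "(cmod z)\<^sup>2 * a_real p y = c_real p y" using a by simp
  then show thesis using that y(1) 1 by blast
qed

lemma compact_boundary_curve: "compact (boundary_curve p y1)"
  unfolding boundary_curve_def by (intro compact_Un compact_continuous_image continuous_on_X compact_Icc)

lemma open_G: "open (G_domain p y1)"
  unfolding G_domain_def by (intro open_inside compact_imp_closed compact_boundary_curve)

text \<open>The arcs \<open>X_plus\<close> and \<open>X_minus\<close> join \<open>x1\<close> to 1 in
  the upper and in the lower half-plane and meet the real axis only at these ends, so they enclose
  the open segment.\<close>

lemma of_real_in_G:
  assumes "x1 < x" "x < 1"
  shows "of_real x \<in> G_domain p y1"
proof -
  have "of_real x \<notin> boundary_curve p y1"
    using of_real_in_boundary_curve assms by fastforce
  then show ?thesis
    unfolding G_domain_def boundary_curve_def using y1 assms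
    by (intro of_real_in_inside_arcs[OF _ continuous_on_X X_ends] Im_X) auto
qed

end

section \<open>Expansions at an interior origin\<close>

lemma islimpt_positive_reals: "(0::complex) islimpt of_real ` {0<..}"
  unfolding islimpt_approachable
proof (intro allI impI)
  fix e :: real assume "e > 0"
  then show "\<exists>x'\<in>of_real ` {0<..}. x' \<noteq> (0::complex) \<and> dist x' 0 < e"
    by (intro bexI[OF _ imageI[of "e / 2"]]) auto
qed

lemma has_fps_expansion_imp_expands_at_0:
  assumes "g has_fps_expansion F" and "0 islimpt S"
    and "\<forall>\<^sub>F z in at 0 within S. f z = g z"
  shows "expands_at_0 S f F"
proof -
  have "\<forall>\<^sub>F z in at 0 within S. eval_fps F z = g z"
    using assms(1) at_within_le_nhds[of 0 S] by (auto simp: has_fps_expansion_def intro: filter_leD)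
  with assms(3) have "\<forall>\<^sub>F z in at 0 within S. f z = eval_fps F z"
    by eventually_elim simp
  then show ?thesis using assms(1,2) by (simp add: expands_at_0_def has_fps_expansion_def)
qed

lemma has_fps_expansion_small_root:
  assumes "p 1 1 = 0" "p 0 1 > 0"
  shows "small_root p has_fps_expansion fps_expansion (small_root p) 0"
    and "fps_expansion (small_root p) 0 $ 0 = 0"
    and "kernel_at (transpose_fun p) (fps_expansion (small_root p) 0) = 0"
proof -
  show *: "small_root p has_fps_expansion fps_expansion (small_root p) 0"
    using small_root_analytic[of p, OF assms] analytic_at_imp_has_fps_expansion_0 by blast
  show "fps_expansion (small_root p) 0 $ 0 = 0"
    using small_root_0[of p, OF assms] by (simp add: fps_expansion_def)
  show "kernel_at (transpose_fun p) (fps_expansion (small_root p) 0) = 0"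
    using kernel_at_root[OF * small_root_kernel[of p, OF assms]] .
qed

lemma fps_cnj_small_root:
  assumes "p 1 1 = 0" "p 0 1 > 0"
  shows "fps_cnj (fps_expansion (small_root p) 0) = fps_expansion (small_root p) 0"
proof -
  have "isCont (discr_real p) 0"
    unfolding discr_real_def a_real_def b_real_def c_real_def by (intro continuous_intros)
  moreover have "discr_real p 0 > 0"
    using assms by (simp add: discr_real_def a_real_def b_real_def c_real_def)
  ultimately have "\<forall>\<^sub>F s in nhds 0. discr_real p s > 0"
    using isCont_eventually_in_open[where f = "discr_real p" and U = "{0<..}"] by simp
  then obtain \<delta> where \<delta>: "\<delta> > 0" "\<And>s. dist s 0 < \<delta> \<Longrightarrow> discr_real p s > 0"
    unfolding eventually_nhds_metric by blast
  show ?thesis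
  proof (rule fps_cnj_eq_if_real_values[OF has_fps_expansion_small_root(1)[of p, OF assms] \<delta>(1)])
    fix s assume "- \<delta> < s" "s < 0"
    then have "discr_real p s > 0" by (intro \<delta>(2)) auto
    then have "csqrt (discr p (of_real s)) = of_real (sqrt (discr_real p s))"
      by (simp add: discr_of_real)
    then have "small_root p (of_real s) = of_real (2 * c_real p s / (- b_real p s - sqrt (discr_real p s)))"
      by (simp add: small_root_def b_tilde_of_real c_tilde_of_real)
    then show "small_root p (of_real s) \<in> \<real>" by (simp only: Reals_of_real)
  qed
qed

locale gluing = branch_walk +
  fixes \<omega> :: "complex \<Rightarrow> complex"
  assumes gluing: "conformal_gluing p y1 \<omega>"
begin

lemma gluing_facts:
  "\<omega> holomorphic_on G_domain p y1" "continuous_on (closure (G_domain p y1) - {1}) \<omega>"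
  "\<And>y. y \<in> {y1..1} \<Longrightarrow> \<omega> (X_plus p (of_real y)) = \<omega> (X_minus p (of_real y))"
  "inj_on \<omega> (G_domain p y1)" "\<And>x. x \<in> G_domain p y1 \<Longrightarrow> deriv \<omega> x \<noteq> 0" "\<omega> 0 = 0"
  using gluing by (auto simp: conformal_gluing_def solves_bvp_def)

text \<open>The common goal of both positions of the origin. The last clause asks for real
  \<open>W\<close> and \<open>V\<close>, from which \<open>real_representation\<close> derives real
  \<open>P\<close>.\<close>

definition good_expansions :: "complex fps \<Rightarrow> complex fps \<Rightarrow> bool" where
  "good_expansions W V \<longleftrightarrow>
     expands_at_0 (closure (G_domain p y1)) \<omega> W \<and>
     expands_at_0 (of_real ` {0<..}) (\<lambda>y. \<omega> (X_plus p y)) V \<and>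
     fps_nth W 0 = 0 \<and> fps_nth V 0 = 0 \<and>
     (\<forall>h\<in>harmonic_functions p. \<exists>!P. fps_nth P 0 = 0 \<and> represented_by p W V h P) \<and>
     ((\<forall>x\<in>G_domain p y1. \<omega> (cnj x) = cnj (\<omega> x)) \<longrightarrow> fps_cnj W = W \<and> fps_cnj V = V)"

text \<open>Here \<open>x1 < 0\<close>, so 0 is an interior point. \<open>W\<close> is the Taylor
  series of \<omega>, with nonzero linear coefficient by conformality, and \<open>V\<close> is its
  composition with the series of the small root.\<close>

lemma good_expansions_interior:
  assumes p01: "p 0 1 > 0"
  shows "\<exists>W V. good_expansions W V"
proof -
  let ?G = "G_domain p y1"
  have "x1 < 0"
    using b_real_y1_pos[OF p01] a_real_pos_on[of y1] by (simp add: x1_def field_simps)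
  then have G: "0 \<in> ?G" using of_real_in_G[of 0] by simp
  define W where "W = fps_expansion \<omega> 0"
  define X where "X = fps_expansion (small_root p) 0"
  note root = has_fps_expansion_small_root[of p, OF p11 p01, folded X_def]
  have W: "\<omega> has_fps_expansion W"
    unfolding W_def using gluing_facts(1) open_G G
    by (intro analytic_at_imp_has_fps_expansion_0) (auto simp: analytic_at)
  have W0: "W $ 0 = 0" and W1: "W $ 1 \<noteq> 0"
    using gluing_facts(5)[OF G] gluing_facts(6) by (simp_all add: W_def fps_expansion_def)
  have V: "(\<lambda>y. \<omega> (small_root p y)) has_fps_expansion (W oo X)"
    using has_fps_expansion_compose[OF W root(1,2)] by (simp add: o_def)
  have lim: "0 islimpt closure ?G"
    using G open_G interior_limit_point[of 0 "closure ?G"] closure_subset interior_maximal by blast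
  have "expands_at_0 (closure ?G) \<omega> W"
    using has_fps_expansion_imp_expands_at_0[OF W lim] by simp
  moreover have "expands_at_0 (of_real ` {0<..}) (\<lambda>y. \<omega> (X_plus p y)) (W oo X)"
  proof (rule has_fps_expansion_imp_expands_at_0[OF V islimpt_positive_reals])
    have "\<forall>\<^sub>F y in at 0 within of_real ` {0<..}. a_tilde p y \<noteq> 0 \<longrightarrow> X_plus p y = small_root p y"
      using X_plus_eq_small_root[of p, OF p11 p01] at_within_le_nhds filter_leD by blast
    moreover have "\<forall>\<^sub>F y in at 0 within of_real ` {0<..}. y \<in> of_real ` {0<..}"
      by (simp add: eventually_at_filter)
    ultimately show "\<forall>\<^sub>F y in at 0 within of_real ` {0<..}. \<omega> (X_plus p y) = \<omega> (small_root p y)"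
    proof eventually_elim
      case (elim y)
      then have "a_tilde p y \<noteq> 0" using a_real_pos by (force simp: a_tilde_of_real)
      with elim show ?case by simp
    qed
  qed
  moreover have "(W oo X) $ 0 = 0" using W0 by simp
  moreover have "\<forall>h\<in>harmonic_functions p. \<exists>!P. P $ 0 = 0 \<and> represented_by p W (W oo X) h P"
    using ex1_representation_x[OF _ p11 root(2,3) W0 W1] by blast
  moreover have "fps_cnj W = W \<and> fps_cnj (W oo X) = W oo X"
    if sym: "\<forall>x\<in>?G. \<omega> (cnj x) = cnj (\<omega> x)"
  proof -
    have W_real: "fps_cnj W = W"
    proof (rule fps_cnj_eq_if_real_values[OF W, of "- x1"])
      fix s assume "- (- x1) < s" "s < 0"
      then have "of_real s \<in> ?G" by (intro of_real_in_G) auto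
      then show "\<omega> (of_real s) \<in> \<real>" using sym by (metis Reals_cnj_iff complex_cnj_complex_of_real)
    qed (use \<open>x1 < 0\<close> in simp)
    moreover have "fps_cnj X = X"
      unfolding X_def by (rule fps_cnj_small_root[of p, OF p11 p01])
    ultimately show ?thesis by (simp add: fps_cnj_compose)
  qed
  ultimately show ?thesis using W0 unfolding good_expansions_def by blast
qed

end

section \<open>The case of an origin on the boundary curve\<close>

locale boundary_gluing = gluing +
  assumes p01: "p 0 1 = 0"
begin

lemma positive_steps: "p 1 0 > 0" "p (-1) 1 > 0"
  using no_three_zeros(7,8) p01 p11 nonneg(3,8) by linarith+

lemma y1_zero: "y1 = 0"
  using y1_eq_0 p01 .

lemma x1_zero: "x1 = 0"
proof -
  have "b_real p y1 = 0" by (simp add: y1_zero b_real_def p01)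
  then show ?thesis unfolding x1_def by simp
qed

definition b_cofactor :: "complex \<Rightarrow> complex" where
  "b_cofactor y = of_real (p 0 0 - 1) + of_real (p 0 (-1)) * y"

text \<open>This is \<open>- discr p y / y\<close>: for \<open>p 0 1 = p 1 1 = 0\<close> both
  \<open>b_tilde\<close> and \<open>c_tilde\<close> contain a factor y. Its value at 0 is positive,
  so its principal square root is analytic there.\<close>

definition discr_quotient :: "complex \<Rightarrow> complex" where
  "discr_quotient y = 4 * a_tilde p y * (of_real (p 1 0) + of_real (p 1 (-1)) * y) - y * (b_cofactor y)\<^sup>2"

lemma b_tilde_factor: "b_tilde p y = y * b_cofactor y"
  by (simp add: b_tilde_eq b_cofactor_def p01 power2_eq_square algebra_simps)

lemma discr_factor: "discr p y = - y * discr_quotient y"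
  by (simp add: discr_def b_tilde_factor discr_quotient_def c_tilde_eq p11 power2_eq_square algebra_simps)

text \<open>At \<open>y = - t^2\<close> a square root of the discriminant is
  \<open>t * csqrt (discr_quotient y)\<close>. Inserting it into the quadratic formula gives a root
  divisible by \<open>t\<close>, and \<open>eta\<close> is the quotient.\<close>

definition eta :: "complex \<Rightarrow> complex" where
  "eta t = (t * b_cofactor (- t\<^sup>2) + csqrt (discr_quotient (- t\<^sup>2))) / (2 * a_tilde p (- t\<^sup>2))"

text \<open>\<open>t = \<surd>(- y)\<close> resolves the square-root branch point of \<open>X\<^sub>\<plusminus>(y)\<close> at \<open>y = 0\<close>: \<open>xi\<close> is a local
  coordinate around \<open>0\<close> in which the boundary curve is the imaginary axis.\<close>

definition xi :: "complex \<Rightarrow> complex" where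
  "xi t = t * eta t"

text \<open>Since \<open>p 1 0 > 0\<close>, the kernel equation can be solved for y near the
  origin.\<close>

abbreviation (input) Y :: "complex \<Rightarrow> complex" where
  "Y \<equiv> small_root (transpose_fun p)"

text \<open>The local inverse of \<open>xi\<close>: the equation
  \<open>2 a x + b = t * csqrt (discr_quotient y)\<close> solved for \<open>t\<close> at
  \<open>y = Y x\<close>.\<close>

definition tau :: "complex \<Rightarrow> complex" where
  "tau x = (2 * a_tilde p (Y x) * x + b_tilde p (Y x)) / csqrt (discr_quotient (Y x))"

lemma xi_eq:
  assumes "a_tilde p (- t\<^sup>2) \<noteq> 0"
  shows "2 * a_tilde p (- t\<^sup>2) * xi t + b_tilde p (- t\<^sup>2) = t * csqrt (discr_quotient (- t\<^sup>2))"
proof -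
  have "2 * a_tilde p (- t\<^sup>2) * eta t = t * b_cofactor (- t\<^sup>2) + csqrt (discr_quotient (- t\<^sup>2))"
    using assms by (simp add: eta_def)
  then show ?thesis unfolding xi_def b_tilde_factor by algebra
qed

lemma kernel_transpose_fun:
  "a_tilde (transpose_fun p) x * y\<^sup>2 + b_tilde (transpose_fun p) x * y + c_tilde (transpose_fun p) x
   = a_tilde p y * x\<^sup>2 + b_tilde p y * x + c_tilde p y"
  by (simp add: a_tilde_eq b_tilde_eq c_tilde_eq algebra_simps)

lemma square_completion:
  "(2 * a_tilde p y * x + b_tilde p y)\<^sup>2
   = 4 * a_tilde p y * (a_tilde p y * x\<^sup>2 + b_tilde p y * x + c_tilde p y) + discr p y"
  by (simp add: discr_def power2_eq_square algebra_simps)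

lemma values_0:
  "a_tilde p 0 = of_real (p (-1) 1)" "discr_quotient 0 = of_real (4 * p (-1) 1 * p 1 0)"
  "discr_quotient 0 \<notin> \<real>\<^sub>\<le>\<^sub>0" "csqrt (discr_quotient 0) = of_real (sqrt (4 * p (-1) 1 * p 1 0))"
proof -
  show "a_tilde p 0 = of_real (p (-1) 1)" by (simp add: a_tilde_eq)
  show d: "discr_quotient 0 = of_real (4 * p (-1) 1 * p 1 0)"
    by (simp add: discr_quotient_def a_tilde_eq)
  have "4 * p (-1) 1 * p 1 0 > 0" using positive_steps by simp
  then show "discr_quotient 0 \<notin> \<real>\<^sub>\<le>\<^sub>0" "csqrt (discr_quotient 0) = of_real (sqrt (4 * p (-1) 1 * p 1 0))"
    unfolding d by (simp_all only: nonpos_Reals_of_real_iff csqrt_of_real less_imp_le not_le)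
qed

lemma analytic_on_discr_quotient [analytic_intros]:
  "f analytic_on S \<Longrightarrow> (\<lambda>z. discr_quotient (f z)) analytic_on S"
  unfolding discr_quotient_def b_cofactor_def by (intro analytic_intros)

lemma analytic_on_eta:
  assumes "\<And>t. t \<in> S \<Longrightarrow> a_tilde p (- t\<^sup>2) \<noteq> 0" "\<And>t. t \<in> S \<Longrightarrow> discr_quotient (- t\<^sup>2) \<notin> \<real>\<^sub>\<le>\<^sub>0"
  shows "eta analytic_on S"
  unfolding eta_def b_cofactor_def using assms by (intro analytic_intros) auto

lemmas Y_facts = small_root_analytic[of "transpose_fun p", OF p11 positive_steps(1)]
  small_root_0[of "transpose_fun p", OF p11 positive_steps(1)]

lemma analytic_on_tau: "tau analytic_on {0}"
  unfolding tau_def using Y_facts values_0(3) by (intro analytic_intros) (auto simp: Y_facts(2))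

lemma isCont_0:
  "isCont eta 0" "isCont xi 0" "isCont tau 0"
proof -
  show eta: "isCont eta 0"
    using values_0 positive_steps by (intro analytic_at_imp_isCont analytic_on_eta) auto
  show "isCont xi 0" unfolding xi_def by (intro continuous_intros eta)
  show "isCont tau 0" using analytic_on_tau by (rule analytic_at_imp_isCont)
qed

lemma points_at_0: "xi 0 = 0" "tau 0 = 0" "Re (eta 0) > 0"
proof -
  show "xi 0 = 0" by (simp add: xi_def)
  show "tau 0 = 0" unfolding tau_def Y_facts(2) by (simp add: b_tilde_factor)
  have "eta 0 = of_real (sqrt (4 * p (-1) 1 * p 1 0) / (2 * p (-1) 1))"
    unfolding eta_def using values_0 by simp
  then show "Re (eta 0) > 0" using positive_steps by simp
qed

lemma eventually_Y:
  "\<forall>\<^sub>F x in nhds 0. a_tilde p (Y x) * x\<^sup>2 + b_tilde p (Y x) * x + c_tilde p (Y x) = 0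
     \<and> a_tilde p (Y x) \<noteq> 0 \<and> discr_quotient (Y x) \<noteq> 0"
proof (intro eventually_conj)
  show "\<forall>\<^sub>F x in nhds 0. a_tilde p (Y x) * x\<^sup>2 + b_tilde p (Y x) * x + c_tilde p (Y x) = 0"
    using small_root_kernel[of "transpose_fun p", OF p11 positive_steps(1)]
    unfolding kernel_transpose_fun .
  have "isCont (\<lambda>x. a_tilde p (Y x)) 0" "isCont (\<lambda>x. discr_quotient (Y x)) 0"
    using Y_facts(1) by (intro analytic_at_imp_isCont analytic_intros; assumption)+
  note cont = this
  show "\<forall>\<^sub>F x in nhds 0. a_tilde p (Y x) \<noteq> 0"
    using isCont_eventually_in_open[OF cont(1), of "- {0}"] values_0 positive_steps Y_facts(2)
    by (simp add: open_Compl)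
  show "\<forall>\<^sub>F x in nhds 0. discr_quotient (Y x) \<noteq> 0"
    using isCont_eventually_in_open[OF cont(2), of "- {0}"] values_0 positive_steps Y_facts(2)
    by (simp add: open_Compl)
qed

lemma tau_square:
  assumes "a_tilde p (Y x) * x\<^sup>2 + b_tilde p (Y x) * x + c_tilde p (Y x) = 0" "discr_quotient (Y x) \<noteq> 0"
  shows "(tau x)\<^sup>2 = - Y x"
  using assms unfolding tau_def power_divide square_completion by (simp add: discr_factor)

lemma xi_tau:
  assumes "a_tilde p (Y x) * x\<^sup>2 + b_tilde p (Y x) * x + c_tilde p (Y x) = 0"
    "a_tilde p (Y x) \<noteq> 0" "discr_quotient (Y x) \<noteq> 0"
  shows "xi (tau x) = x"
proof -
  have sq: "- (tau x)\<^sup>2 = Y x" using tau_square assms by simp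
  have "2 * a_tilde p (Y x) * xi (tau x) + b_tilde p (Y x) = tau x * csqrt (discr_quotient (Y x))"
    using xi_eq[of "tau x"] assms(2) unfolding sq by blast
  also have "\<dots> = 2 * a_tilde p (Y x) * x + b_tilde p (Y x)"
    using assms(3) by (simp add: tau_def)
  finally show ?thesis using assms(2) by simp
qed

lemma xi_kernel:
  assumes "a_tilde p (- t\<^sup>2) \<noteq> 0"
  shows "a_tilde p (- t\<^sup>2) * (xi t)\<^sup>2 + b_tilde p (- t\<^sup>2) * xi t + c_tilde p (- t\<^sup>2) = 0"
proof -
  have "(2 * a_tilde p (- t\<^sup>2) * xi t + b_tilde p (- t\<^sup>2))\<^sup>2 = discr p (- t\<^sup>2)"
    unfolding xi_eq[OF assms] by (simp add: power_mult_distrib discr_factor)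
  then show ?thesis using assms unfolding square_completion by simp
qed

lemma xi_of_real:
  assumes "discr_quotient (- (of_real s)\<^sup>2) \<notin> \<real>\<^sub>\<le>\<^sub>0" "Re (eta (of_real s)) > 0"
  shows "xi (of_real s) = of_real (s * Re (eta (of_real s)))"
proof -
  have e: "discr_quotient (- (of_real s)\<^sup>2) = of_real (Re (discr_quotient (- (of_real s)\<^sup>2)))"
    by (simp add: complex_eq_iff discr_quotient_def b_cofactor_def a_tilde_eq flip: of_real_power of_real_minus)
  have "csqrt (discr_quotient (- (of_real s)\<^sup>2)) \<in> \<real>"
    using assms(1) by (subst e, subst csqrt_of_real) (auto simp: e[symmetric] complex_nonpos_Reals_iff, metis Im_complex_of_real e linear)
  then have "eta (of_real s) \<in> \<real>"
    unfolding eta_def b_cofactor_def a_tilde_eq by (intro Reals_divide Reals_add Reals_mult) auto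
  then have "eta (of_real s) = of_real (Re (eta (of_real s)))" by (simp add: complex_is_Real_iff complex_eq_iff)
  then show ?thesis unfolding xi_def by (metis of_real_mult)
qed

text \<open>On the imaginary axis \<open>y = s^2\<close> is nonnegative and the two signs of
  \<open>t\<close> give the two roots. They are compared as unordered pairs, since the sign of
  \<open>csqrt\<close> is immaterial for the gluing condition.\<close>

lemma xi_imaginary:
  "{xi (\<i> * of_real s), xi (- (\<i> * of_real s))} = {X_plus p (of_real (s\<^sup>2)), X_minus p (of_real (s\<^sup>2))}"
  if "a_tilde p (of_real (s\<^sup>2)) \<noteq> 0"
proof -
  define y :: complex where "y = of_real (s\<^sup>2)"
  define w where "w = \<i> * of_real s * csqrt (discr_quotient y)"
  have sq: "- (\<i> * of_real s)\<^sup>2 = y" "- (- (\<i> * of_real s))\<^sup>2 = y"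
    by (simp_all add: y_def power_mult_distrib)
  have a: "a_tilde p y \<noteq> 0" using that by (simp add: y_def)
  have "w\<^sup>2 = discr p y" by (simp add: w_def power_mult_distrib discr_factor y_def)
  then have "w\<^sup>2 = (csqrt (discr p y))\<^sup>2" by simp
  then have w: "w = csqrt (discr p y) \<or> w = - csqrt (discr p y)" by (simp only: power2_eq_iff)
  have "2 * a_tilde p y * xi (\<i> * of_real s) = - b_tilde p y + w"
    "2 * a_tilde p y * xi (- (\<i> * of_real s)) = - b_tilde p y - w"
    using xi_eq[of "\<i> * of_real s"] xi_eq[of "- (\<i> * of_real s)"] a unfolding sq w_def
    by algebra+
  then have "xi (\<i> * of_real s) = (- b_tilde p y + w) / (2 * a_tilde p y)"
    "xi (- (\<i> * of_real s)) = (- b_tilde p y - w) / (2 * a_tilde p y)"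
    using a by (simp_all add: eq_divide_eq mult.commute)
  then show ?thesis using w unfolding X_plus_def X_minus_def y_def[symmetric] by auto
qed

lemma tau_xi:
  assumes "Y (xi t) = - t\<^sup>2" "a_tilde p (- t\<^sup>2) \<noteq> 0" "discr_quotient (- t\<^sup>2) \<notin> \<real>\<^sub>\<le>\<^sub>0"
  shows "tau (xi t) = t"
proof -
  have "discr_quotient (- t\<^sup>2) \<noteq> 0" using assms(3) by auto
  then show ?thesis unfolding tau_def assms(1) xi_eq[OF assms(2)] by simp
qed

text \<open>Common radii for everything that the continuation of \<omega> needs. The inverse
  \<open>tau\<close> supplies injectivity and local surjectivity of \<open>xi\<close>.\<close>

lemma local_parameter:
  obtains \<delta> \<epsilon> where "\<delta> > 0" "\<epsilon> > 0" "\<delta> \<le> 1" "xi holomorphic_on ball 0 \<delta>"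
    and "\<And>t. norm t < \<delta> \<Longrightarrow> Y (xi t) = - t\<^sup>2" "inj_on xi (ball 0 \<delta>)"
    and "\<And>t. norm t < \<delta> \<Longrightarrow> xi t \<in> boundary_curve p y1 \<Longrightarrow> Re t = 0"
    and "\<And>t. norm t < \<delta> \<Longrightarrow> norm (xi t) < 1"
    and "\<And>s. \<bar>s\<bar> < \<delta> \<Longrightarrow> \<exists>c>0. xi (of_real s) = of_real (s * c)"
    and "\<And>x. norm x < \<epsilon> \<Longrightarrow> \<exists>t. norm t < \<delta> \<and> xi t = x"
proof -
  obtain r where r: "r > 0" "\<And>x y. norm y < r \<Longrightarrow> norm x < r \<Longrightarrow>
      a_tilde p y * x\<^sup>2 + b_tilde p y * x + c_tilde p y = 0 \<Longrightarrow> y = Y x"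
    using small_root_unique[of "transpose_fun p", OF p11 positive_steps(1)]
    unfolding kernel_transpose_fun by blast
  have "isCont (\<lambda>x::complex. (norm x)\<^sup>2 / p 1 0) 0" "isCont (\<lambda>x::complex. norm x) 0"
    using positive_steps by (auto intro!: continuous_intros)
  note ev = isCont_eventually_in_open[OF this(1), of "{..<r}"] isCont_eventually_in_open[OF this(2), of "{..<min r 1}"]
  have "\<forall>\<^sub>F x::complex in nhds 0. (norm x)\<^sup>2 / p 1 0 < r" "\<forall>\<^sub>F x::complex in nhds 0. norm x < min r 1"
    using ev r(1) by simp_all
  with eventually_Y have "\<forall>\<^sub>F x in nhds 0. a_tilde p (Y x) * x\<^sup>2 + b_tilde p (Y x) * x + c_tilde p (Y x) = 0
     \<and> a_tilde p (Y x) \<noteq> 0 \<and> discr_quotient (Y x) \<noteq> 0 \<and> (norm x)\<^sup>2 / p 1 0 < r \<and> norm x < min r 1"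
    by eventually_elim blast
  then obtain d where d: "d > 0" "\<And>x. norm x < d \<Longrightarrow>
      a_tilde p (Y x) * x\<^sup>2 + b_tilde p (Y x) * x + c_tilde p (Y x) = 0
     \<and> a_tilde p (Y x) \<noteq> 0 \<and> discr_quotient (Y x) \<noteq> 0 \<and> (norm x)\<^sup>2 / p 1 0 < r \<and> norm x < r \<and> norm x < 1"
    unfolding eventually_nhds_metric by auto
  \<comment> \<open>A curve point \<open>x\<close> belongs to some \<open>y\<close> in [0,1] with
    \<open>p 1 0 * y\<close> at most \<open>(cmod x)^2\<close>. For small \<open>x\<close> this
    \<open>y\<close> is small too, so uniqueness gives \<open>y = Y x\<close>. Then
    \<open>tau x\<close> has the nonpositive real square \<open>- y\<close> and is
    imaginary.\<close>
  have curve: "Re (tau x) = 0" if x: "x \<in> boundary_curve p y1" "norm x < d" for x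
  proof -
    obtain y where y: "y \<in> {y1..1}" "a_tilde p (of_real y) * x\<^sup>2 + b_tilde p (of_real y) * x + c_tilde p (of_real y) = 0"
        "(cmod x)\<^sup>2 * a_real p y = c_real p y"
      using boundary_curve_root[OF x(1)] by blast
    have y01: "0 \<le> y" "y \<le> 1" using y(1) y1_zero by auto
    have "a_real p y \<le> p (-1) 1 + p (-1) 0 + p (-1) (-1)"
      unfolding a_real_def using nonneg y01
      by (intro add_mono mult_left_le) (auto simp: power_le_one)
    also have "\<dots> \<le> 1" using total nonneg by linarith
    finally have "(cmod x)\<^sup>2 * a_real p y \<le> (cmod x)\<^sup>2 * 1" by (intro mult_left_mono) auto
    moreover have "p 1 0 * y \<le> c_real p y" unfolding c_real_def using p11 nonneg y01 by simp
    ultimately have "p 1 0 * y \<le> (cmod x)\<^sup>2" using y(3) by simp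
    then have "y \<le> (cmod x)\<^sup>2 / p 1 0" using positive_steps(1) by (simp add: field_simps)
    then have "norm (complex_of_real y) < r" using d(2)[OF x(2)] y01 by simp
    then have "of_real y = Y x" using d(2)[OF x(2)] y(2) by (intro r(2)) auto
    then have sq: "(tau x)\<^sup>2 = - of_real y" using tau_square[of x] d(2)[OF x(2)] by simp
    have "Re ((tau x)\<^sup>2) = - y" "Im ((tau x)\<^sup>2) = 0" unfolding sq by simp_all
    then have "(Re (tau x))\<^sup>2 - (Im (tau x))\<^sup>2 = - y" "Re (tau x) * Im (tau x) = 0"
      by (auto simp: power2_eq_square)
    then have "Re (tau x) = 0 \<or> (Re (tau x))\<^sup>2 = - y" by auto
    moreover have "(Re (tau x))\<^sup>2 \<ge> 0" by simp
    ultimately have "Re (tau x) = 0 \<or> (Re (tau x))\<^sup>2 = 0" using y01(1) by linarith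
    then show ?thesis by simp
  qed
  have c1: "isCont (\<lambda>t. a_tilde p (- t\<^sup>2)) 0" "isCont (\<lambda>t. discr_quotient (- t\<^sup>2)) 0" "isCont (\<lambda>t. norm (- t\<^sup>2 :: complex)) 0"
    "isCont (\<lambda>t. norm (xi t)) 0" "isCont (\<lambda>t. Re (eta t)) 0" "isCont (\<lambda>t::complex. norm t) 0"
    using isCont_0 by (auto intro!: analytic_at_imp_isCont analytic_intros continuous_intros)
  have "\<forall>\<^sub>F t in nhds 0. a_tilde p (- t\<^sup>2) \<noteq> 0 \<and> discr_quotient (- t\<^sup>2) \<notin> \<real>\<^sub>\<le>\<^sub>0 \<and> norm (- t\<^sup>2) < r \<and>
      norm (xi t) < d \<and> Re (eta t) > 0 \<and> norm t < 1"
    using isCont_eventually_in_open[OF c1(1), of "- {0}"] isCont_eventually_in_open[OF c1(2), of "- \<real>\<^sub>\<le>\<^sub>0"]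
      isCont_eventually_in_open[OF c1(3), of "{..<r}"] isCont_eventually_in_open[OF c1(4), of "{..<d}"]
      isCont_eventually_in_open[OF c1(5), of "{0<..}"] isCont_eventually_in_open[OF c1(6), of "{..<1}"]
      values_0 positive_steps points_at_0 r(1) d(1)
    by (intro eventually_conj) (simp_all add: open_Compl)
  then obtain \<delta>' where \<delta>': "\<delta>' > 0" "\<And>t. norm t < \<delta>' \<Longrightarrow> a_tilde p (- t\<^sup>2) \<noteq> 0 \<and> discr_quotient (- t\<^sup>2) \<notin> \<real>\<^sub>\<le>\<^sub>0 \<and> norm (- t\<^sup>2) < r \<and>
      norm (xi t) < d \<and> Re (eta t) > 0 \<and> norm t < 1"
    unfolding eventually_nhds_metric by auto
  define \<delta> where "\<delta> = min \<delta>' 1"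
  have \<delta>: "\<delta> > 0" "\<delta> \<le> 1" "\<And>t. norm t < \<delta> \<Longrightarrow> a_tilde p (- t\<^sup>2) \<noteq> 0" "\<And>t. norm t < \<delta> \<Longrightarrow> discr_quotient (- t\<^sup>2) \<notin> \<real>\<^sub>\<le>\<^sub>0"
    "\<And>t::complex. norm t < \<delta> \<Longrightarrow> norm (- t\<^sup>2) < r" "\<And>t. norm t < \<delta> \<Longrightarrow> norm (xi t) < d" "\<And>t. norm t < \<delta> \<Longrightarrow> Re (eta t) > 0"
    using \<delta>' by (simp_all add: \<delta>_def)
  have Y_xi: "Y (xi t) = - t\<^sup>2" if t: "norm t < \<delta>" for t
    using r(2)[OF \<delta>(5)[OF t] _ xi_kernel[OF \<delta>(3)[OF t]]] d(2)[OF \<delta>(6)[OF t]] by simp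
  have tau_xi': "tau (xi t) = t" if t: "norm t < \<delta>" for t
    using tau_xi[OF Y_xi[OF t] \<delta>(3,4)[OF t]] .
  \<comment> \<open>For surjectivity: \<open>x = xi (tau x)\<close>, and continuity keeps
    \<open>tau x\<close> in the disc for small \<open>x\<close>.\<close>
  have "isCont (\<lambda>x. norm (tau x)) 0" using isCont_0 by (intro continuous_intros)
  then have "\<forall>\<^sub>F x in nhds 0. norm (tau x) < \<delta>"
    using isCont_eventually_in_open[where U = "{..<\<delta>}" and f = "\<lambda>x. norm (tau x)"] \<delta>(1) points_at_0 by simp
  then obtain \<epsilon>' where \<epsilon>': "\<epsilon>' > 0" "\<And>x. norm x < \<epsilon>' \<Longrightarrow> norm (tau x) < \<delta>"
    unfolding eventually_nhds_metric by auto
  show thesis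
  proof (rule that[of \<delta> "min d \<epsilon>'"])
    show "\<delta> > 0" "\<delta> \<le> 1" "min d \<epsilon>' > 0" using \<delta> \<epsilon>' d by auto
    have "eta analytic_on ball 0 \<delta>" using \<delta> by (intro analytic_on_eta) auto
    then have "eta holomorphic_on ball 0 \<delta>" by (rule analytic_imp_holomorphic)
    then show "xi holomorphic_on ball 0 \<delta>" unfolding xi_def by (intro holomorphic_intros)
    show "inj_on xi (ball 0 \<delta>)" using tau_xi' by (metis inj_onI mem_ball_0)
    show "Y (xi t) = - t\<^sup>2" if "norm t < \<delta>" for t using Y_xi that .
    show "Re t = 0" if "norm t < \<delta>" "xi t \<in> boundary_curve p y1" for t
      using curve[OF that(2) \<delta>(6)[OF that(1)]] tau_xi'[OF that(1)] by simp
    show "norm (xi t) < 1" if "norm t < \<delta>" for t using d(2)[OF \<delta>(6)[OF that]] by simp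
    show "\<exists>c>0. xi (of_real s) = of_real (s * c)" if "\<bar>s\<bar> < \<delta>" for s
      using xi_of_real[of s] \<delta>(4,7)[of "of_real s"] that by auto
    show "\<exists>t. norm t < \<delta> \<and> xi t = x" if "norm x < min d \<epsilon>'" for x
      using that d(2)[of x] \<epsilon>'(2)[of x] xi_tau[of x] by auto
  qed
qed

section \<open>Continuation of \<omega> across the boundary curve at the origin\<close>

lemma good_expansions_boundary: "\<exists>W V. good_expansions W V"
proof (rule local_parameter)
  let ?G = "G_domain p y1" and ?\<Gamma> = "boundary_curve p y1"
  fix \<delta> \<epsilon> :: real
  assume pos: "\<delta> > 0" "\<epsilon> > 0" "\<delta> \<le> 1" and xi_hol: "xi holomorphic_on ball 0 \<delta>"
    and Y_xi: "\<And>t. norm t < \<delta> \<Longrightarrow> Y (xi t) = - t\<^sup>2" and xi_inj: "inj_on xi (ball 0 \<delta>)"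
    and xi_curve: "\<And>t. norm t < \<delta> \<Longrightarrow> xi t \<in> ?\<Gamma> \<Longrightarrow> Re t = 0"
    and xi_less_1: "\<And>t. norm t < \<delta> \<Longrightarrow> norm (xi t) < 1"
    and xi_real: "\<And>s. \<bar>s\<bar> < \<delta> \<Longrightarrow> \<exists>c>0. xi (of_real s) = of_real (s * c)"
    and xi_onto: "\<And>x. norm x < \<epsilon> \<Longrightarrow> \<exists>t. norm t < \<delta> \<and> xi t = x"
  have xi_cont: "continuous_on (ball 0 \<delta>) xi" using xi_hol by (rule holomorphic_on_imp_continuous_on)
  have xi_pos: "\<exists>x. 0 < x \<and> x < 1 \<and> xi (of_real s) = of_real x" if s: "0 < s" "s < \<delta>" for s
  proof -
    obtain c where c: "c > 0" "xi (of_real s) = of_real (s * c)" using xi_real[of s] s by auto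
    have "norm (complex_of_real (s * c)) < 1" using xi_less_1[of "of_real s"] c s by simp
    then show ?thesis using c s by (intro exI[of _ "s * c"]) (auto simp: norm_mult)
  qed
  have half_connected: "connected (xi ` (ball 0 \<delta> \<inter> H))" if "convex H" for H
    using that by (intro connected_continuous_image continuous_on_subset[OF xi_cont] convex_connected convex_Int) auto

  \<comment> \<open>The image of the right half-disc is connected, avoids the curve and contains a
    real point of (0,1), which is in the domain.\<close>
  have in_G: "xi t \<in> ?G" if t: "norm t < \<delta>" "Re t > 0" for t
  proof -
    let ?E = "xi ` (ball 0 \<delta> \<inter> {t. Re t > 0})"
    obtain x where x: "0 < x" "x < 1" "xi (of_real (\<delta> / 2)) = of_real x" using xi_pos[of "\<delta> / 2"] pos by auto
    have "xi (of_real (\<delta> / 2)) \<in> ?E" using pos by (intro imageI) auto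
    moreover have "xi t \<in> ?E" using t by auto
    moreover have "?E \<subseteq> - ?\<Gamma>" using xi_curve by force
    ultimately have "connected_component (- ?\<Gamma>) (of_real x) (xi t)"
      using half_connected[OF convex_halfspace_Re_gt] x(3) unfolding connected_component_def by metis
    then show ?thesis using of_real_in_G[of x] x(1,2) x1_zero inside_same_component unfolding G_domain_def by fastforce
  qed
  \<comment> \<open>The image of the left half-disc meets the negative real axis; their union is
    connected, unbounded and disjoint from the curve, hence outside it.\<close>
  have not_in_closure: "xi t \<notin> closure ?G" if t: "norm t < \<delta>" "Re t < 0" for t
  proof -
    let ?E = "xi ` (ball 0 \<delta> \<inter> {t. Re t < 0})"
    let ?C = "of_real ` {..<0::real} :: complex set"
    have "connected (?E \<union> ?C)"
    proof (rule connected_Un)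
      show "connected ?E" using half_connected[OF convex_halfspace_Re_lt] .
      show "connected ?C" by (intro connected_continuous_image continuous_intros) auto
      obtain c where c: "c > 0" "xi (of_real (- \<delta> / 2)) = of_real (- \<delta> / 2 * c)"
        using xi_real[of "- \<delta> / 2"] pos by auto
      have "xi (of_real (- \<delta> / 2)) \<in> ?E" using pos by (intro imageI) auto
      moreover have "of_real (- \<delta> / 2 * c) \<in> ?C" using c pos by (intro imageI) (auto simp: mult_less_0_iff)
      ultimately show "?E \<inter> ?C \<noteq> {}" using c(2) by auto
    qed
    moreover have "?E \<inter> ?\<Gamma> = {}" using xi_curve by force
    moreover have "?C \<inter> ?\<Gamma> = {}" using of_real_in_boundary_curve x1_zero by force
    moreover have "\<not> bounded ?C"
    proof
      assume "bounded ?C"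
      then obtain B where B: "\<And>z. z \<in> ?C \<Longrightarrow> norm z \<le> B" unfolding bounded_iff by blast
      have "norm (complex_of_real (- (\<bar>B\<bar> + 1))) \<le> B" by (rule B) (intro imageI, simp)
      then show False unfolding norm_of_real by linarith
    qed
    ultimately have "?E \<union> ?C \<subseteq> outside ?\<Gamma>"
      by (intro connected_unbounded_subset_outside) (auto dest: bounded_subset)
    then have "xi t \<in> outside ?\<Gamma>" using t by auto
    moreover have "open (outside ?\<Gamma>)" using compact_boundary_curve by (simp add: open_outside compact_imp_closed)
    moreover have "outside ?\<Gamma> \<inter> ?G = {}" unfolding G_domain_def by (simp add: inside_Int_outside Int_commute)
    ultimately show ?thesis by (metis disjoint_iff open_Int_closure_eq_empty)
  qed
  \<comment> \<open>Shifting \<open>t\<close> to the right by \<open>1 / Suc n\<close> approximates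
    \<open>xi t\<close> from inside the domain; the point 1 is excluded by
    \<open>norm (xi t) < 1\<close>.\<close>
  have in_closure: "xi t \<in> closure ?G - {1}" if t: "norm t < \<delta>" "Re t \<ge> 0" for t
  proof -
    have "(\<lambda>n. t + of_real (1 / Suc n)) \<longlonglongrightarrow> t + of_real 0"
      by (intro tendsto_intros LIMSEQ_Suc[OF lim_1_over_n])
    then have lim: "(\<lambda>n. t + of_real (1 / Suc n)) \<longlonglongrightarrow> t" by simp
    have ev: "\<forall>\<^sub>F n in sequentially. t + of_real (1 / Suc n) \<in> ball 0 \<delta>"
      using topological_tendstoD[OF lim open_ball, of 0 \<delta>] t by simp
    have "isCont xi t" using xi_cont t by (simp add: continuous_on_eq_continuous_at)
    then have "(\<lambda>n. xi (t + of_real (1 / Suc n))) \<longlonglongrightarrow> xi t"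
      using lim isCont_tendsto_compose by blast
    moreover have "\<forall>\<^sub>F n in sequentially. xi (t + of_real (1 / Suc n)) \<in> closure ?G"
      using ev
    proof eventually_elim
      case (elim n)
      have "xi (t + of_real (1 / Suc n)) \<in> ?G" using elim t(2) by (intro in_G) (auto simp: add_nonneg_pos)
      then show ?case using closure_subset by blast
    qed
    ultimately have "xi t \<in> closure ?G"
      by (intro Lim_in_closed_set[of "closure ?G" _ sequentially]) auto
    then show ?thesis using xi_less_1[OF t(1)] by auto
  qed
  have glue: "\<omega> (xi t) = \<omega> (xi (- t))"
    "\<omega> (X_plus p (- t\<^sup>2)) = \<omega> (xi t)" if t: "norm t < \<delta>" "Re t = 0" for t
  proof -
    define s where "s = Im t"
    have ts: "t = \<i> * of_real s" using t by (simp add: s_def complex_eq_iff)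
    \<comment> \<open>The bound \<open>\<delta> \<le> 1\<close> keeps \<open>s^2\<close> in the
      interval [0,1] on which the gluing condition holds.\<close>
    have "\<bar>s\<bar> \<le> 1" using t pos(3) unfolding ts by (simp add: norm_mult)
    then have y: "s\<^sup>2 \<in> {y1..1}" by (simp add: y1_zero abs_square_le_1)
    have "a_tilde p (of_real (s\<^sup>2)) \<noteq> 0"
      using a_real_pos_on[of "s\<^sup>2"] y unfolding a_tilde_of_real by simp
    from xi_imaginary[OF this]
    have "{xi t, xi (- t)} = {X_plus p (of_real (s\<^sup>2)), X_minus p (of_real (s\<^sup>2))}" unfolding ts .
    moreover have "\<omega> (X_plus p (of_real (s\<^sup>2))) = \<omega> (X_minus p (of_real (s\<^sup>2)))"
      using gluing_facts(3)[OF y] .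
    moreover have "- t\<^sup>2 = of_real (s\<^sup>2)" by (simp add: ts power_mult_distrib)
    ultimately show "\<omega> (xi t) = \<omega> (xi (- t))" "\<omega> (X_plus p (- t\<^sup>2)) = \<omega> (xi t)"
      by (auto simp: doubleton_eq_iff)
  qed

  \<comment> \<open>The even continuation of \<open>\<omega> \<circ> xi\<close> from the right
    half-disc. By the gluing condition the two formulas agree on the imaginary axis, so
    \<open>f\<close> is continuous and can be pasted holomorphically across it.\<close>
  define f where "f t = (if Re t \<le> 0 then \<omega> (xi (- t)) else \<omega> (xi t))" for t
  have f_right: "f t = \<omega> (xi t)" if "norm t < \<delta>" "Re t \<ge> 0" for t
    using that glue(1)[of t] by (auto simp: f_def)
  have f_left: "f t = \<omega> (xi (- t))" if "Re t \<le> 0" for t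
    using that by (simp add: f_def)
  have f_even: "f (- t) = f t" if "norm t < \<delta>" for t
    using that f_right[of t] f_left[of t] f_right[of "- t"] f_left[of "- t"] by (cases "Re t \<le> 0") auto
  have f_cont: "continuous_on (ball 0 \<delta>) f"
    unfolding f_def
  proof (rule continuous_on_cases_le)
    show "continuous_on {t \<in> ball 0 \<delta>. Re t \<le> 0} (\<lambda>t. \<omega> (xi (- t)))"
      using in_closure by (intro continuous_on_compose2[OF gluing_facts(2)] continuous_on_compose2[OF xi_cont] continuous_intros) auto
    show "continuous_on {t \<in> ball 0 \<delta>. 0 \<le> Re t} (\<lambda>t. \<omega> (xi t))"
      using in_closure by (intro continuous_on_compose2[OF gluing_facts(2)] continuous_on_subset[OF xi_cont]) auto
    show "continuous_on (ball 0 \<delta>) Re" by (intro continuous_intros)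
    show "\<omega> (xi (- t)) = \<omega> (xi t)" if "t \<in> ball 0 \<delta>" "Re t = 0" for t
      using glue(1)[of t] that by simp
  qed
  have f_hol: "f holomorphic_on ball 0 \<delta>"
  proof (rule holomorphic_on_paste_across_line[of _ 1 _ 0])
    have "(\<omega> \<circ> xi) holomorphic_on ball 0 \<delta> \<inter> {t. 0 < Re t}"
      using in_G by (intro holomorphic_on_compose_gen[OF holomorphic_on_subset[OF xi_hol] gluing_facts(1)]) auto
    then show "f holomorphic_on ball 0 \<delta> \<inter> {t. 0 < 1 \<bullet> t}"
      using f_right by (subst holomorphic_cong[of _ _ _ "\<omega> \<circ> xi"]) (auto simp: inner_complex_def)
    have "(\<omega> \<circ> (xi \<circ> uminus)) holomorphic_on ball 0 \<delta> \<inter> {t. Re t < 0}"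
      using in_G by (intro holomorphic_on_compose_gen[OF _ gluing_facts(1)] holomorphic_on_compose_gen[OF _ xi_hol] holomorphic_intros) auto
    then show "f holomorphic_on ball 0 \<delta> \<inter> {t. 1 \<bullet> t < 0}"
      using f_left by (subst holomorphic_cong[of _ _ _ "\<omega> \<circ> (xi \<circ> uminus)"]) (auto simp: inner_complex_def)
  qed (use f_cont in auto)

  let ?D = "ball (0::complex) (\<delta>\<^sup>2)"
  \<comment> \<open>An even function of \<open>t\<close> is a function of \<open>y = - t^2\<close>;
    evenness makes the choice of the square root irrelevant.\<close>
  define g where "g y = f (csqrt (- y))" for y
  have norm_csqrt_less: "norm (csqrt z) < \<delta>" if "norm z < \<delta>\<^sup>2" for z
  proof -
    have "(norm (csqrt z))\<^sup>2 = norm z" by (simp flip: norm_power)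
    then show ?thesis using that pos(1) power2_less_imp_less[of "norm (csqrt z)" \<delta>] by simp
  qed
  have g_square: "g (- t\<^sup>2) = f t" if "norm t < \<delta>" for t
  proof -
    have "(csqrt (t\<^sup>2))\<^sup>2 = t\<^sup>2" by simp
    then have "csqrt (t\<^sup>2) = t \<or> csqrt (t\<^sup>2) = - t" by (simp only: power2_eq_iff)
    then show ?thesis using f_even[OF that] by (auto simp: g_def)
  qed
  have g_right: "Re (csqrt (- y)) > 0" if "y \<notin> \<real>\<^sub>\<ge>\<^sub>0" for y
  proof -
    have "Re (csqrt (- y)) \<noteq> 0"
    proof
      assume "Re (csqrt (- y)) = 0"
      then have "csqrt (- y) = \<i> * of_real (Im (csqrt (- y)))" by (simp add: complex_eq_iff)
      then have "- y = (\<i> * of_real (Im (csqrt (- y))))\<^sup>2" by (metis power2_csqrt)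
      then have "y = of_real ((Im (csqrt (- y)))\<^sup>2)" by (simp add: power_mult_distrib)
      then show False using that by (metis nonneg_Reals_of_real_iff zero_le_power2)
    qed
    then show ?thesis using Re_csqrt[of "- y"] by linarith
  qed
  \<comment> \<open>The root \<open>csqrt (- y)\<close> is holomorphic off the nonnegative reals and
    \<open>\<i> * csqrt y\<close> off the nonpositive ones. Together they leave out only 0, where
    continuity removes the singularity.\<close>
  have g_hol: "g holomorphic_on ?D"
  proof (rule no_isolated_singularity[of _ _ "{0}"])
    have "g holomorphic_on (?D - \<real>\<^sub>\<ge>\<^sub>0)"
    proof -
      have "(f \<circ> (\<lambda>y. csqrt (- y))) holomorphic_on (?D - \<real>\<^sub>\<ge>\<^sub>0)"
        using norm_csqrt_less
        by (intro holomorphic_on_compose_gen[OF _ f_hol] holomorphic_intros) (auto simp: complex_nonpos_Reals_iff complex_nonneg_Reals_iff)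
      then show ?thesis by (simp add: g_def[abs_def] o_def)
    qed
    moreover have "g holomorphic_on (?D - \<real>\<^sub>\<le>\<^sub>0)"
    proof -
      have "(f \<circ> (\<lambda>y. \<i> * csqrt y)) holomorphic_on (?D - \<real>\<^sub>\<le>\<^sub>0)"
        using norm_csqrt_less
        by (intro holomorphic_on_compose_gen[OF _ f_hol] holomorphic_intros) (auto simp: norm_mult)
      moreover have "g y = (f \<circ> (\<lambda>y. \<i> * csqrt y)) y" if "y \<in> ?D" for y
        using g_square[of "\<i> * csqrt y"] norm_csqrt_less[of y] that by (simp add: norm_mult power_mult_distrib)
      ultimately show ?thesis by (subst holomorphic_cong[of _ _ _ "f \<circ> (\<lambda>y. \<i> * csqrt y)"]) auto
    qed
    ultimately have "g holomorphic_on (?D - \<real>\<^sub>\<ge>\<^sub>0) \<union> (?D - \<real>\<^sub>\<le>\<^sub>0)"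
      by (intro holomorphic_on_Un) (auto intro!: open_Diff)
    moreover have "?D - {0} \<subseteq> (?D - \<real>\<^sub>\<ge>\<^sub>0) \<union> (?D - \<real>\<^sub>\<le>\<^sub>0)"
      by (auto simp: complex_nonneg_Reals_iff complex_nonpos_Reals_iff complex_eq_iff)
    ultimately show g_hol': "g holomorphic_on (?D - {0})" by (rule holomorphic_on_subset)
    have "isCont g y" if y: "y \<in> ?D" for y
    proof (cases "y = 0")
      case True
      have "(\<lambda>y. csqrt (- y)) \<midarrow>0\<rightarrow> 0"
      proof (rule tendsto_norm_zero_cancel)
        have "norm (csqrt (- y)) = sqrt (norm y)" for y
          by (rule real_sqrt_unique[symmetric]) (simp_all flip: norm_power)
        moreover have "(\<lambda>y::complex. sqrt (norm y)) \<midarrow>0\<rightarrow> sqrt (norm (0::complex))"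
          by (intro tendsto_intros)
        ultimately show "(\<lambda>y. norm (csqrt (- y))) \<midarrow>0\<rightarrow> 0" by simp
      qed
      moreover have "isCont f 0" using f_cont pos(1) by (simp add: continuous_on_eq_continuous_at)
      ultimately have "(\<lambda>y. f (csqrt (- y))) \<midarrow>0\<rightarrow> f 0" using isCont_tendsto_compose by blast
      then show ?thesis by (simp add: True isCont_def g_def[abs_def])
    next
      case False
      then show ?thesis
        using y holomorphic_on_imp_continuous_on[OF g_hol'] by (simp add: continuous_on_eq_continuous_at open_Diff)
    qed
    then show "continuous_on ?D g" by (simp add: continuous_at_imp_continuous_on)
  qed auto
  \<comment> \<open>Off the nonnegative reals \<open>csqrt (- y)\<close> lies in the right
    half-disc, where \<open>\<omega> \<circ> xi\<close> is injective. The omitted slit is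
    negligible.\<close>
  have "inj_on g ?D"
  proof (rule inj_on_if_inj_off_negligible[OF g_hol])
    have "(\<real>\<^sub>\<ge>\<^sub>0 :: complex set) \<subseteq> {z. \<i> \<bullet> z = 0}" by (auto simp: complex_nonneg_Reals_iff inner_complex_def)
    then show "negligible (\<real>\<^sub>\<ge>\<^sub>0 :: complex set)"
      using negligible_hyperplane[of \<i> 0] negligible_subset by auto
    show "inj_on g (?D - \<real>\<^sub>\<ge>\<^sub>0)"
    proof (rule inj_onI)
      fix y z assume y: "y \<in> ?D - \<real>\<^sub>\<ge>\<^sub>0" and z: "z \<in> ?D - \<real>\<^sub>\<ge>\<^sub>0" and eq: "g y = g z"
      let ?s = "csqrt (- y)" and ?t = "csqrt (- z)"
      have s: "norm ?s < \<delta>" "Re ?s > 0" and t: "norm ?t < \<delta>" "Re ?t > 0"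
        using y z norm_csqrt_less g_right by auto
      have "\<omega> (xi ?s) = \<omega> (xi ?t)" using eq s t f_right by (simp add: g_def)
      then have "xi ?s = xi ?t" using gluing_facts(4) in_G[OF s] in_G[OF t] by (auto dest: inj_onD)
      then have "?s = ?t" using xi_inj s t by (auto dest: inj_onD)
      then have "?s\<^sup>2 = ?t\<^sup>2" by simp
      then show "y = z" by simp
    qed
  qed (auto simp: pos)
  then have g_deriv: "deriv g 0 \<noteq> 0"
    using holomorphic_injective_imp_regular[OF g_hol] pos(1) by simp

  \<comment> \<open>With \<open>x = xi t\<close> one has \<open>Y x = - t^2\<close>, so
    \<open>g (Y x)\<close> is \<open>\<omega> x\<close> on the closure of the domain near 0. Thus
    \<open>V\<close> and \<open>V oo Z\<close> expand \<omega> along the curve and in the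
    domain.\<close>
  define V where "V = fps_expansion g 0"
  define Z where "Z = fps_expansion Y 0"
  note root = has_fps_expansion_small_root[of "transpose_fun p", OF p11 positive_steps(1), folded Z_def]
  have V: "g has_fps_expansion V"
    unfolding V_def using g_hol pos(1)
    by (intro analytic_at_imp_has_fps_expansion_0) (auto simp: analytic_at intro!: exI[of _ ?D])
  have g0: "g 0 = 0" using g_square[of 0] f_right[of 0] pos(1) gluing_facts(6) by (simp add: points_at_0)
  have V0: "V $ 0 = 0" and V1: "V $ 1 \<noteq> 0" using g_deriv g0 by (simp_all add: V_def fps_expansion_def)
  have W: "(\<lambda>x. g (Y x)) has_fps_expansion (V oo Z)"
    using has_fps_expansion_compose[OF V root(1,2)] by (simp add: o_def)

  have "0 islimpt closure ?G"
  proof -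
    have "\<exists>z\<in>?G. z \<noteq> 0 \<and> dist z 0 < e" if "e > 0" for e
      using that of_real_in_G[of "min e 1 / 2"] x1_zero by (intro bexI[of _ "of_real (min e 1 / 2)"]) auto
    then have "0 islimpt ?G" unfolding islimpt_approachable by blast
    then show ?thesis by (rule islimpt_subset[OF _ closure_subset])
  qed
  then have "expands_at_0 (closure ?G) \<omega> (V oo Z)"
  proof (rule has_fps_expansion_imp_expands_at_0[OF W])
    have "\<omega> x = g (Y x)" if x: "x \<in> closure ?G" "norm x < \<epsilon>" for x
    proof -
      obtain t where t: "norm t < \<delta>" "xi t = x" using xi_onto x(2) by blast
      then have "Re t \<ge> 0" using not_in_closure[of t] x(1) by force
      then show ?thesis using f_right[OF t(1)] g_square[OF t(1)] Y_xi[OF t(1)] t(2) by simp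
    qed
    then show "\<forall>\<^sub>F x in at 0 within closure ?G. \<omega> x = g (Y x)"
      using pos(2) unfolding eventually_at by (intro exI[of _ \<epsilon>]) auto
  qed
  moreover have "expands_at_0 (of_real ` {0<..}) (\<lambda>y. \<omega> (X_plus p y)) V"
  proof (rule has_fps_expansion_imp_expands_at_0[OF V islimpt_positive_reals])
    have "\<omega> (X_plus p (of_real y)) = g (of_real y)" if y: "0 < y" "y < \<delta>\<^sup>2" for y
    proof -
      \<comment> \<open>A positive \<open>y\<close> has an imaginary parameter. There
        \<open>X_plus\<close> is one of \<open>xi t\<close> and \<open>xi (- t)\<close>, and
        \<omega> takes the same value at both.\<close>
      define t where "t = \<i> * of_real (sqrt y)"
      have "sqrt y < \<delta>" using y pos(1) by (simp add: real_less_lsqrt)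
      then have t: "norm t < \<delta>" "Re t = 0" using y by (simp_all add: t_def norm_mult)
      have "- t\<^sup>2 = of_real y" using y by (simp add: t_def power_mult_distrib flip: of_real_power)
      then show ?thesis using glue(2)[OF t] f_right[OF t(1)] g_square[OF t(1)] t(2) by simp
    qed
    then show "\<forall>\<^sub>F y in at 0 within of_real ` {0<..}. \<omega> (X_plus p y) = g y"
      using pos(1) unfolding eventually_at by (intro exI[of _ "\<delta>\<^sup>2"]) auto
  qed
  moreover have "(V oo Z) $ 0 = 0" using V0 by simp
  moreover have "\<forall>h\<in>harmonic_functions p. \<exists>!P. P $ 0 = 0 \<and> represented_by p (V oo Z) V h P"
    using ex1_representation_y[OF _ p11 root(2,3) V0 V1] by blast
  moreover have "fps_cnj (V oo Z) = V oo Z \<and> fps_cnj V = V"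
    if sym: "\<forall>x\<in>?G. \<omega> (cnj x) = cnj (\<omega> x)"
  proof -
    have "fps_cnj V = V"
    proof (rule fps_cnj_eq_if_real_values[OF V, of "\<delta>\<^sup>2"])
      fix s assume s: "- \<delta>\<^sup>2 < s" "s < 0"
      \<comment> \<open>A negative \<open>s\<close> has a positive real parameter, which
        \<open>xi\<close> maps to a real point of the domain, where the assumed symmetry makes
        \<omega> real.\<close>
      define t where "t = sqrt (- s)"
      have t: "0 < t" "t < \<delta>" using s pos(1) by (simp_all add: t_def real_less_lsqrt)
      obtain x where x: "0 < x" "x < 1" "xi (of_real t) = of_real x" using xi_pos[OF t] by blast
      have "- (complex_of_real t)\<^sup>2 = of_real s" using s by (simp add: t_def flip: of_real_power)
      then have "g (of_real s) = \<omega> (of_real x)"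
        using g_square[of "of_real t"] f_right[of "of_real t"] t x(3) by simp
      moreover have "of_real x \<in> ?G" using x x1_zero by (intro of_real_in_G) auto
      ultimately show "g (of_real s) \<in> \<real>" using sym by (metis Reals_cnj_iff complex_cnj_complex_of_real)
    qed (use pos in simp)
    moreover have "fps_cnj Z = Z"
      unfolding Z_def by (rule fps_cnj_small_root[of "transpose_fun p", OF p11 positive_steps(1)])
    ultimately show ?thesis by (simp add: fps_cnj_compose)
  qed
  ultimately show ?thesis using V0 unfolding good_expansions_def by blast
qed

end

section \<open>Combination of the two positions of the origin\<close>

theorem theorem1:
  fixes p :: "int \<Rightarrow> int \<Rightarrow> real" and y1 :: real and \<omega> :: "complex \<Rightarrow> complex"
  assumes "transition_probabilities p" and "nondegenerate p" and "zero_drift p"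
    and "y1 \<in> {-1..<1}" and "discr p (of_real y1) = 0"
    and "conformal_gluing p y1 \<omega>"
  shows "(p 1 1 = 0 \<longrightarrow>
            (\<exists>W V. expands_at_0 (closure (G_domain p y1)) \<omega> W \<and>
               expands_at_0 (of_real ` {0<..}) (\<lambda>y. \<omega> (X_plus p y)) V \<and>
               fps_nth W 0 = 0 \<and> fps_nth V 0 = 0 \<and>
               (\<forall>h\<in>harmonic_functions p. \<exists>!P. fps_nth P 0 = 0 \<and> represented_by p W V h P) \<and>
               ((\<forall>x\<in>G_domain p y1. \<omega> (cnj x) = cnj (\<omega> x)) \<longrightarrow>
                  (\<forall>h\<in>harmonic_functions p. \<forall>P. fps_nth P 0 = 0 \<and> represented_by p W V h P \<longrightarrow>
                     (\<forall>n. fps_nth P n \<in> \<real>)))))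
         \<and> (\<exists>\<phi>. linear_iso_to_fps (harmonic_functions p) \<phi>)"
proof (intro conjI impI)
  interpret walk p using assms by unfold_locales
  show "\<exists>\<phi>. linear_iso_to_fps (harmonic_functions p) \<phi>" by (rule ex_linear_iso)
  assume p11: "p 1 1 = 0"
  interpret gluing p y1 \<omega> using assms p11 by unfold_locales
  have "\<exists>W V. good_expansions W V"
  proof (cases "p 0 1 > 0")
    case True
    then show ?thesis by (rule good_expansions_interior)
  next
    case False
    then interpret boundary_gluing p y1 \<omega> using nonneg(6) by unfold_locales simp
    show ?thesis by (rule good_expansions_boundary)
  qed
  then obtain W V where WV: "good_expansions W V" by blast
  then have ex1: "\<exists>!P. P $ 0 = 0 \<and> represented_by p W V h P" if "h \<in> harmonic_functions p" for h
    using that by (simp add: good_expansions_def)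
  have real: "P $ n \<in> \<real>"
    if "\<forall>x\<in>G_domain p y1. \<omega> (cnj x) = cnj (\<omega> x)" "h \<in> harmonic_functions p"
      "P $ 0 = 0" "represented_by p W V h P" for h P n
    using real_representation[OF ex1[OF that(2)] _ _ that(3,4)] WV that(1) by (simp add: good_expansions_def)
  show "\<exists>W V. expands_at_0 (closure (G_domain p y1)) \<omega> W \<and>
      expands_at_0 (of_real ` {0<..}) (\<lambda>y. \<omega> (X_plus p y)) V \<and>
      fps_nth W 0 = 0 \<and> fps_nth V 0 = 0 \<and>
      (\<forall>h\<in>harmonic_functions p. \<exists>!P. fps_nth P 0 = 0 \<and> represented_by p W V h P) \<and>
      ((\<forall>x\<in>G_domain p y1. \<omega> (cnj x) = cnj (\<omega> x)) \<longrightarrow>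
         (\<forall>h\<in>harmonic_functions p. \<forall>P. fps_nth P 0 = 0 \<and> represented_by p W V h P \<longrightarrow>
            (\<forall>n. fps_nth P n \<in> \<real>)))"
    using WV real unfolding good_expansions_def by (intro exI[of _ W] exI[of _ V]) blast
qed

end
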